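(* Let $(A,\pi)$ be a weighted $C^*$-algebra, where $A$ is a self-adjoint $C^*$-Segal algebra in the $C^*$-algebra $C$ and $\pi:A\to M(C)$. Then there exists $u\in Z(M(C))_+$ such that $A=u\pi(A)$. In particular, $E_A=uC$ and $M_C(A)=uM(C)$.
   Context: Algebras are complex; ideals are two-sided. A Banach algebra $A$ with norm $\|\cdot\|$ is a $C^*$-Segal algebra (in the $C^*$-algebra $C$) if there is a continuous injective homomorphism $\iota:A\to C$ whose image is a dense ideal of $C$; $A$ is identified with $\iota(A)\subseteq C$. It is self-adjoint if $\iota(A)$ is closed under the involution of $C$. Standing convention: for self-adjoint $A$, the norm is assumed to satisfy $\|a^*\|=\|a\|$ for all $a\in A$. $A_+:=A\cap C_+$. A weighted $C^*$-algebra is a pair $(A,\pi)$ where $A$ is a self-adjoint $C^*$-Segal algebra in a $C^*$-algebra $C$ and $\pi:A\to M(C)$ is a positive (i.e. $\pi(A_+)\subseteq M(C)_+$) isometric (from $\|\cdot\|$ to the norm of $M(C)$) $C$-bimodule homomorphism. Here $M(C)$ is the multiplier algebra of $C$ and $Z(M(C))$ its centre; $Z(M(C))_+$ is the set of positive elements of the centre. The multiplier norm on $A$ is $\|a\|_M=\sup_{\|b\|\le1}\{\|ab\|,\|ba\|\}$; $\widetilde A_M$ is the completion of $(A,\|\cdot\|_M)$, in which $A$ is an ideal; the approximate ideal is $E_A:=A\widetilde A_M=\{ax:a\in A,\ x\in\widetilde A_M\}$. (For a $C^*$-Segal algebra, $\|\cdot\|_M$ and $\|\cdot\|_C$ are equivalent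 on $A$, so $\widetilde A_M$ is $C$ up to equivalent renorming and $E_A=\{ac:a\in A,\ c\in C\}$.) $M_C(A)$ is the set of $C$-multipliers of $A$: pairs $m=(m_l,m_r)$ of maps $C\to A$ with $m_l(xy)=m_l(x)y$, $m_r(xy)=xm_r(y)$, $xm_l(y)=m_r(x)y$ for all $x,y\in C$. Since $A\subseteq C$, $M_C(A)$ is regarded as a subset of $M(C)$; $a\in A$ corresponds to the pair $x\mapsto ax$, $x\mapsto xa$. *)

theory Defs
  imports "HOL-Analysis.Analysis"
begin

section \<open>Complex Banach algebras and C*-algebras\<close>

text \<open>
  The library has real Banach algebras only.  Algebras are not assumed to be unital, and the zero
  algebra is allowed.
\<close>

class complex_banach_algebra = real_normed_algebra + banach +
  fixes scaleC :: "complex \<Rightarrow> 'a \<Rightarrow> 'a"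
  assumes scaleC_add_right: "scaleC z (x + y) = scaleC z x + scaleC z y"
    and scaleC_add_left: "scaleC (z + w) x = scaleC z x + scaleC w x"
    and scaleC_scaleC: "scaleC z (scaleC w x) = scaleC (z * w) x"
    and scaleC_of_real: "scaleC (of_real r) x = scaleR r x"
    and mult_scaleC_left: "scaleC z x * y = scaleC z (x * y)"
    and mult_scaleC_right: "x * scaleC z y = scaleC z (x * y)"
    and norm_scaleC: "norm (scaleC z x) = norm z * norm x"

class cstar_algebra = complex_banach_algebra +
  fixes star :: "'a \<Rightarrow> 'a"
  assumes star_star: "star (star x) = x"
    and star_add: "star (x + y) = star x + star y"
    and star_scaleC: "star (scaleC z x) = scaleC (cnj z) (star x)"
    and star_mult: "star (x * y) = star y * star x"
    and cstar_identity: "norm (star x * x) = (norm x)\<^sup>2"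

text \<open>
  The form \<open>y\<^sup>* y\<close> needs no unitization, unlike the spectral description.
\<close>

definition positive :: "'a::cstar_algebra \<Rightarrow> bool"
  where "positive x \<longleftrightarrow> (\<exists>y. x = star y * y)"

definition centre :: "'a::times set"
  where "centre = {z. \<forall>x. z * x = x * z}"

lemma scaleC_minus_right: "scaleC z (x - y) = scaleC z x - scaleC z (y::'a::complex_banach_algebra)"
  by (metis add_diff_cancel_right' diff_add_cancel scaleC_add_right)

lemma star_diff: "star (x - y) = star x - star (y::'a::cstar_algebra)"
  by (metis add_diff_cancel_right' diff_add_cancel star_add)

lemma star_zero [simp]: "star (0::'a::cstar_algebra) = 0"
  using star_diff[of "0::'a" 0] by simp

lemma star_scaleR: "star (scaleR r x) = scaleR r (star (x::'a::cstar_algebra))"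
  by (metis complex_cnj_complex_of_real scaleC_of_real star_scaleC)

lemma norm_star [simp]: "norm (star x) = norm (x::'a::cstar_algebra)"
proof -
  have le: "norm y \<le> norm (star y)" for y :: 'a
  proof (cases "y = 0")
    case False
    have "norm y * norm y \<le> norm (star y) * norm y"
      using norm_mult_ineq[of "star y" y] cstar_identity[of y] by (simp add: power2_eq_square)
    then show ?thesis using False by simp
  qed simp
  show ?thesis using le[of x] le[of "star x"] by (simp add: star_star)
qed

lemma norm_mult_star: "norm (x * star x) = (norm (x::'a::cstar_algebra))\<^sup>2"
  using cstar_identity[of "star x"] by (simp add: star_star)

lemma star_mult_eq_0 [simp]: "star x * x = 0 \<longleftrightarrow> x = (0::'a::cstar_algebra)"
  by (metis cstar_identity mult_zero_right norm_eq_zero power_eq_0_iff)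

lemma left_faithful: "(\<And>z. z * x = z * y) \<Longrightarrow> x = (y::'a::cstar_algebra)"
  by (metis star_mult_eq_0 right_diff_distrib eq_iff_diff_eq_0)

lemma right_faithful:
  assumes "\<And>z. x * z = y * z" shows "x = (y::'a::cstar_algebra)"
proof -
  have "star x = star y"
    by (rule left_faithful) (metis assms star_mult star_star)
  then show ?thesis by (metis star_star)
qed

lemma norm_le_left_mult:
  fixes x :: "'a::cstar_algebra"
  assumes "\<And>z. norm (z * x) \<le> K * norm z" "0 \<le> K"
  shows "norm x \<le> K"
proof (cases "x = 0")
  case False
  have "norm x * norm x \<le> K * norm x"
    using assms(1)[of "star x"] cstar_identity[of x] by (simp add: power2_eq_square)
  then show ?thesis using False by simp
qed (use assms in simp)

lemma norm_le_right_mult: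
  fixes x :: "'a::cstar_algebra"
  assumes "\<And>z. norm (x * z) \<le> K * norm z" "0 \<le> K"
  shows "norm x \<le> K"
proof (cases "x = 0")
  case False
  have "norm x * norm x \<le> K * norm x"
    using assms(1)[of "star x"] norm_mult_star[of x] by (simp add: power2_eq_square)
  then show ?thesis using False by simp
qed (use assms in simp)


section \<open>The multiplier algebra of a C*-algebra\<close>

text \<open>Linearity and boundedness of the two maps are automatic, see below.\<close>

definition double_centralizer :: "('a::times \<Rightarrow> 'a) \<Rightarrow> ('a \<Rightarrow> 'a) \<Rightarrow> bool"
  where "double_centralizer L R \<longleftrightarrow>
    (\<forall>x y. L (x * y) = L x * y \<and> R (x * y) = x * R y \<and> x * L y = R x * y)"

context
  fixes L R :: "'a::cstar_algebra \<Rightarrow> 'a"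
  assumes LR: "double_centralizer L R"
begin

lemma dc_L: "L (x * y) = L x * y" and dc_R: "R (x * y) = x * R y" and dc_LR: "x * L y = R x * y"
  using LR by (auto simp: double_centralizer_def)

lemma dc_L_add: "L (x + y) = L x + L y"
  by (rule left_faithful) (simp add: dc_LR distrib_left)

lemma dc_R_add: "R (x + y) = R x + R y"
  by (rule right_faithful) (simp add: dc_LR[symmetric] distrib_right)

lemma dc_L_scaleC: "L (scaleC c x) = scaleC c (L x)"
  by (rule left_faithful) (simp add: dc_LR mult_scaleC_right)

lemma dc_R_scaleC: "R (scaleC c x) = scaleC c (R x)"
  by (rule right_faithful) (simp add: dc_LR[symmetric] mult_scaleC_left)

lemma dc_linear: "linear L" "linear R"
  by (auto intro!: linearI simp: dc_L_add dc_R_add scaleC_of_real[symmetric] dc_L_scaleC dc_R_scaleC)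

lemma dc_R_bounded: "\<exists>K. \<forall>x. norm (R x) \<le> K * norm x"
proof -
  define E where "E n = {y. \<forall>x. norm x \<le> 1 \<longrightarrow> norm (R x * y) \<le> real n}" for n
  have closedE: "closed (E n)" for n
  proof -
    have "E n = (\<Inter>x\<in>{x. norm x \<le> 1}. {y. norm (R x * y) \<le> real n})"
      by (auto simp: E_def)
    moreover have "closed {y. norm (R x * y) \<le> real n}" for x
      by (intro closed_Collect_le continuous_intros)
    ultimately show ?thesis by auto
  qed
  have cover: "\<exists>n. y \<in> E n" for y
  proof -
    obtain n where n: "norm (L y) \<le> real n" using real_arch_simple by blast
    have "norm (R x * y) \<le> real n" if "norm x \<le> 1" for x
    proof -
      have "norm (R x * y) \<le> norm x * norm (L y)"
        using norm_mult_ineq[of x "L y"] by (simp add: dc_LR)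
      also have "\<dots> \<le> 1 * norm (L y)" using that by (intro mult_right_mono) auto
      finally show ?thesis using n by simp
    qed
    then show ?thesis by (auto simp: E_def)
  qed
  obtain n where n: "interior (E n) \<noteq> {}"
  proof (rule ccontr)
    assume "\<not> thesis"
    then have int: "interior (E n) = {}" for n using that by blast
    have "(euclidean::'a topology) interior_of \<Union>(range E) = {}"
      by (rule Baire_category_alt)
        (auto simp: completely_metrizable_space_euclidean closedE int)
    moreover have "\<Union>(range E) = UNIV" using cover by auto
    ultimately show False by simp
  qed
  then obtain y0 e where e: "e > 0" "cball y0 e \<subseteq> E n"
    by (metis ex_in_conv mem_interior_cball)
  have small: "norm (R x * z) \<le> 2 * real n" if x: "norm x \<le> 1" and z: "norm z \<le> e" for x z
  proof -
    have "y0 + z \<in> E n" "y0 \<in> E n" using e z by (auto simp: dist_norm subset_eq)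
    then have "norm (R x * (y0 + z)) \<le> real n" "norm (R x * y0) \<le> real n"
      using x by (auto simp: E_def)
    moreover have "R x * z = R x * (y0 + z) - R x * y0" by (simp add: distrib_left)
    ultimately show ?thesis by (metis add_mono mult_2 norm_triangle_le_diff)
  qed
  have unit: "norm (R x) \<le> 2 * real n / e" if x: "norm x \<le> 1" for x
  proof (rule norm_le_right_mult)
    fix z
    show "norm (R x * z) \<le> 2 * real n / e * norm z"
    proof (cases "z = 0")
      case False
      have "norm (R x * (scaleR (e / norm z) z)) \<le> 2 * real n"
        using False e by (intro small x) auto
      then show ?thesis using False e by (simp add: field_simps)
    qed simp
  qed (use e in auto)
  have "norm (R x) \<le> 2 * real n / e * norm x" for x
  proof (cases "x = 0")
    case True
    then show ?thesis using linear_0[OF dc_linear(2)] by simp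
  next
    case False
    have "norm (R (scaleR (1 / norm x) x)) \<le> 2 * real n / e"
      using False by (intro unit) auto
    then show ?thesis using False by (simp add: linear_cmul[OF dc_linear(2)] field_simps)
  qed
  then show ?thesis by blast
qed

lemma dc_L_bound:
  assumes K: "\<And>x. norm (R x) \<le> K * norm x" "0 \<le> K"
  shows "norm (L x) \<le> K * norm x"
proof (rule norm_le_left_mult)
  fix z
  have "norm (z * L x) \<le> norm (R z) * norm x" by (simp add: dc_LR norm_mult_ineq)
  also have "\<dots> \<le> K * norm z * norm x" using K by (intro mult_right_mono) auto
  finally show "norm (z * L x) \<le> K * norm x * norm z" by (simp add: mult_ac)
qed (use K in simp)

lemma dc_R_bound:
  assumes K: "\<And>x. norm (L x) \<le> K * norm x" "0 \<le> K"
  shows "norm (R x) \<le> K * norm x"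
proof (rule norm_le_right_mult)
  fix z
  have "norm (R x * z) \<le> norm x * norm (L z)" by (simp add: dc_LR[symmetric] norm_mult_ineq)
  also have "\<dots> \<le> norm x * (K * norm z)" using K by (intro mult_left_mono) auto
  finally show "norm (R x * z) \<le> K * norm x * norm z" by (simp add: mult_ac)
qed (use K in simp)

lemma dc_bounded_linear: "bounded_linear L" "bounded_linear R"
proof -
  obtain K where K: "\<And>x. norm (R x) \<le> K * norm x" using dc_R_bounded by blast
  have K': "norm (R x) \<le> \<bar>K\<bar> * norm x" for x
    by (rule order_trans[OF K]) (auto intro: mult_right_mono)
  show "bounded_linear L" "bounded_linear R"
    using K' dc_L_bound[of "\<bar>K\<bar>"] dc_linear
    by (auto simp: bounded_linear_def bounded_linear_axioms_def mult.commute)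
qed

lemma dc_onorm_eq: "onorm R = onorm L"
proof (rule antisym)
  show "onorm R \<le> onorm L"
    by (intro onorm_bound dc_R_bound onorm dc_bounded_linear onorm_pos_le)
  show "onorm L \<le> onorm R"
    by (intro onorm_bound dc_L_bound onorm dc_bounded_linear onorm_pos_le)
qed

end

typedef (overloaded) ('a::cstar_algebra) multiplier =
  "{LR :: ('a \<Rightarrow> 'a) \<times> ('a \<Rightarrow> 'a). double_centralizer (fst LR) (snd LR)}"
  by (rule exI[of _ "(\<lambda>_. 0, \<lambda>_. 0)"]) (simp add: double_centralizer_def)

definition lmult :: "'a::cstar_algebra multiplier \<Rightarrow> 'a \<Rightarrow> 'a"
  where "lmult m = fst (Rep_multiplier m)"

definition rmult :: "'a::cstar_algebra multiplier \<Rightarrow> 'a \<Rightarrow> 'a"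
  where "rmult m = snd (Rep_multiplier m)"

definition mk_multiplier :: "('a::cstar_algebra \<Rightarrow> 'a) \<Rightarrow> ('a \<Rightarrow> 'a) \<Rightarrow> 'a multiplier"
  where "mk_multiplier L R = Abs_multiplier (L, R)"

lemma double_centralizer_mult: "double_centralizer (lmult m) (rmult m)"
  using Rep_multiplier[of m] by (simp add: lmult_def rmult_def)

lemma lmult_mk: "double_centralizer L R \<Longrightarrow> lmult (mk_multiplier L R) = L"
  and rmult_mk: "double_centralizer L R \<Longrightarrow> rmult (mk_multiplier L R) = R"
  by (simp_all add: mk_multiplier_def lmult_def rmult_def Abs_multiplier_inverse)

lemmas lmult_times = dc_L[OF double_centralizer_mult]
lemmas rmult_times = dc_R[OF double_centralizer_mult]
lemmas times_lmult = dc_LR[OF double_centralizer_mult]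
lemmas lmult_add = dc_L_add[OF double_centralizer_mult]
lemmas rmult_add = dc_R_add[OF double_centralizer_mult]
lemmas lmult_scaleC = dc_L_scaleC[OF double_centralizer_mult]
lemmas rmult_scaleC = dc_R_scaleC[OF double_centralizer_mult]
lemmas lmult_bounded_linear = dc_bounded_linear(1)[OF double_centralizer_mult]
lemmas rmult_bounded_linear = dc_bounded_linear(2)[OF double_centralizer_mult]

lemma multiplier_eqI:
  assumes "\<And>x. lmult m x = lmult n x" shows "m = n"
proof -
  have "rmult m x = rmult n x" for x
    by (rule right_faithful) (simp add: times_lmult[symmetric] assms)
  then have "Rep_multiplier m = Rep_multiplier n"
    using assms by (auto simp: lmult_def rmult_def intro!: prod_eqI ext)
  then show ?thesis by (simp add: Rep_multiplier_inject)
qed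

text \<open>The norm is the common operator norm of the two components, see \<open>dc_onorm_eq\<close>.\<close>

instantiation multiplier :: (cstar_algebra) real_normed_algebra
begin

definition "0 = mk_multiplier (\<lambda>_. 0) (\<lambda>_. 0 :: 'a)"
definition "m + n = mk_multiplier (\<lambda>x. lmult m x + lmult n x) (\<lambda>x. rmult m x + rmult n (x::'a))"
definition "m - n = mk_multiplier (\<lambda>x. lmult m x - lmult n x) (\<lambda>x. rmult m x - rmult n (x::'a))"
definition "- m = mk_multiplier (\<lambda>x. - lmult m x) (\<lambda>x. - rmult m (x::'a))"
definition "scaleR r m = mk_multiplier (\<lambda>x. scaleR r (lmult m x)) (\<lambda>x. scaleR r (rmult m (x::'a)))"
definition "m * n = mk_multiplier (\<lambda>x. lmult m (lmult n x)) (\<lambda>x. rmult n (rmult m (x::'a)))"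
definition "norm m = onorm (lmult (m :: 'a multiplier))"
definition "dist m n = norm (m - n :: 'a multiplier)"
definition "sgn m = scaleR (inverse (norm m)) (m :: 'a multiplier)"
definition "(uniformity :: ('a multiplier \<times> 'a multiplier) filter) =
  (INF e\<in>{0 <..}. principal {(x, y). dist x y < e})"
definition "open (S :: 'a multiplier set) \<longleftrightarrow>
  (\<forall>x\<in>S. \<forall>\<^sub>F (x', y) in uniformity. x' = x \<longrightarrow> y \<in> S)"

lemma dc_zero: "double_centralizer (\<lambda>_. 0) (\<lambda>_. 0 :: 'a)"
  by (simp add: double_centralizer_def)
lemma dc_plus: "double_centralizer (\<lambda>x. lmult m x + lmult n x) (\<lambda>x. rmult m x + rmult n (x::'a))"
  by (simp add: double_centralizer_def lmult_times rmult_times times_lmult algebra_simps)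
lemma dc_minus: "double_centralizer (\<lambda>x. lmult m x - lmult n x) (\<lambda>x. rmult m x - rmult n (x::'a))"
  by (simp add: double_centralizer_def lmult_times rmult_times times_lmult algebra_simps)
lemma dc_uminus: "double_centralizer (\<lambda>x. - lmult m x) (\<lambda>x. - rmult m (x::'a))"
  by (simp add: double_centralizer_def lmult_times rmult_times times_lmult)
lemma dc_scaleR: "double_centralizer (\<lambda>x. scaleR r (lmult m x)) (\<lambda>x. scaleR r (rmult m (x::'a)))"
  by (simp add: double_centralizer_def lmult_times rmult_times times_lmult)
lemma dc_times: "double_centralizer (\<lambda>x. lmult m (lmult n x)) (\<lambda>x. rmult n (rmult m (x::'a)))"
  by (simp add: double_centralizer_def lmult_times rmult_times times_lmult)

lemmas lmult_simps [simp] =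
  lmult_mk[OF dc_zero, folded zero_multiplier_def]
  lmult_mk[OF dc_plus, folded plus_multiplier_def]
  lmult_mk[OF dc_minus, folded minus_multiplier_def]
  lmult_mk[OF dc_uminus, folded uminus_multiplier_def]
  lmult_mk[OF dc_scaleR, folded scaleR_multiplier_def]
  lmult_mk[OF dc_times, folded times_multiplier_def]

lemmas rmult_simps [simp] =
  rmult_mk[OF dc_zero, folded zero_multiplier_def]
  rmult_mk[OF dc_plus, folded plus_multiplier_def]
  rmult_mk[OF dc_minus, folded minus_multiplier_def]
  rmult_mk[OF dc_uminus, folded uminus_multiplier_def]
  rmult_mk[OF dc_scaleR, folded scaleR_multiplier_def]
  rmult_mk[OF dc_times, folded times_multiplier_def]

instance
proof
  fix m n k :: "'a multiplier" and r s :: real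
  show "scaleR r (m + n) = scaleR r m + scaleR r n"
    by (rule multiplier_eqI) (simp add: scaleR_add_right)
  show "scaleR (r + s) m = scaleR r m + scaleR s m"
    by (rule multiplier_eqI) (simp add: scaleR_add_left)
  show "scaleR r (scaleR s m) = scaleR (r * s) m"
    by (rule multiplier_eqI) simp
  show "scaleR 1 m = m" by (rule multiplier_eqI) simp
  show "m + n + k = m + (n + k)" by (rule multiplier_eqI) (simp add: algebra_simps)
  show "m + n = n + m" by (rule multiplier_eqI) (simp add: algebra_simps)
  show "0 + m = m" by (rule multiplier_eqI) simp
  show "- m + m = 0" by (rule multiplier_eqI) simp
  show "m - n = m + - n" by (rule multiplier_eqI) simp
  show "m * n * k = m * (n * k)" by (rule multiplier_eqI) simp
  show "(m + n) * k = m * k + n * k" by (rule multiplier_eqI) simp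
  show "m * (n + k) = m * n + m * k" by (rule multiplier_eqI) (simp add: lmult_add)
  show "scaleR r m * n = scaleR r (m * n)" by (rule multiplier_eqI) simp
  show "m * scaleR r n = scaleR r (m * n)"
    by (rule multiplier_eqI) (simp add: linear_cmul bounded_linear.linear[OF lmult_bounded_linear])
  show "dist m n = norm (m - n)" by (rule dist_multiplier_def)
  show "sgn m = scaleR (inverse (norm m)) m" by (rule sgn_multiplier_def)
  show "(uniformity :: ('a multiplier \<times> 'a multiplier) filter) =
      (INF e\<in>{0 <..}. principal {(x, y). dist x y < e})" by (rule uniformity_multiplier_def)
  show "open (S :: 'a multiplier set) \<longleftrightarrow>
      (\<forall>x\<in>S. \<forall>\<^sub>F (x', y) in uniformity. x' = x \<longrightarrow> y \<in> S)" for S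
    by (rule open_multiplier_def)
  show "norm m = 0 \<longleftrightarrow> m = 0"
    unfolding norm_multiplier_def onorm_eq_0[OF lmult_bounded_linear]
    by (metis lmult_simps(1) multiplier_eqI)
  show "norm (m + n) \<le> norm m + norm n"
    using onorm_triangle[OF lmult_bounded_linear lmult_bounded_linear, of m n]
    by (simp add: norm_multiplier_def plus_multiplier_def lmult_mk[OF dc_plus])
  show "norm (scaleR r m) = \<bar>r\<bar> * norm m"
    using onorm_scaleR[OF lmult_bounded_linear, of r m]
    by (simp add: norm_multiplier_def scaleR_multiplier_def lmult_mk[OF dc_scaleR])
  show "norm (m * n) \<le> norm m * norm n"
    using onorm_compose[OF lmult_bounded_linear lmult_bounded_linear, of m n]
    by (simp add: norm_multiplier_def times_multiplier_def lmult_mk[OF dc_times] o_def)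
qed

end

lemma norm_lmult_le: "norm (lmult m x) \<le> norm m * norm x"
  unfolding norm_multiplier_def by (rule onorm[OF lmult_bounded_linear])

lemma norm_multiplier_rmult: "norm m = onorm (rmult m)"
  unfolding norm_multiplier_def by (rule dc_onorm_eq[OF double_centralizer_mult, symmetric])

lemma norm_rmult_le: "norm (rmult m x) \<le> norm m * norm x"
  unfolding norm_multiplier_rmult by (rule onorm[OF rmult_bounded_linear])

lemma norm_multiplier_bound:
  "0 \<le> K \<Longrightarrow> (\<And>x. norm (lmult m x) \<le> K * norm x) \<Longrightarrow> norm m \<le> K"
  unfolding norm_multiplier_def by (rule onorm_bound)

instance multiplier :: (cstar_algebra) banach
proof
  fix X :: "nat \<Rightarrow> 'a multiplier"
  assume X: "Cauchy X"
  have CL: "Cauchy (\<lambda>n. lmult (X n) x)" and CR: "Cauchy (\<lambda>n. rmult (X n) x)" for x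
  proof -
    have *: "\<exists>M. \<forall>m\<ge>M. \<forall>n\<ge>M. norm (X m - X n) * norm x < e" if "e > 0" for e
    proof -
      have "e / (norm x + 1) > 0" using that by (simp add: add_nonneg_pos)
      then obtain M where M: "\<And>m n. m \<ge> M \<Longrightarrow> n \<ge> M \<Longrightarrow> norm (X m - X n) < e / (norm x + 1)"
        using X unfolding Cauchy_def dist_norm by metis
      have "norm (X m - X n) * norm x < e" if "m \<ge> M" "n \<ge> M" for m n
      proof -
        have "norm (X m - X n) * norm x \<le> norm (X m - X n) * (norm x + 1)"
          by (intro mult_left_mono) auto
        also have "\<dots> < e"
          using M[OF that] by (simp add: pos_less_divide_eq add_nonneg_pos)
        finally show ?thesis .
      qed
      then show ?thesis by blast
    qed
    show "Cauchy (\<lambda>n. lmult (X n) x)"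
      unfolding Cauchy_def dist_norm
      using * norm_lmult_le[of "X _ - X _" x] by simp (meson le_less_trans)
    show "Cauchy (\<lambda>n. rmult (X n) x)"
      unfolding Cauchy_def dist_norm
      using * norm_rmult_le[of "X _ - X _" x] by simp (meson le_less_trans)
  qed
  define L where "L x = lim (\<lambda>n. lmult (X n) x)" for x
  define R where "R x = lim (\<lambda>n. rmult (X n) x)" for x
  have L: "(\<lambda>n. lmult (X n) x) \<longlonglongrightarrow> L x" for x
    unfolding L_def using CL Cauchy_convergent convergent_LIMSEQ_iff by blast
  have R: "(\<lambda>n. rmult (X n) x) \<longlonglongrightarrow> R x" for x
    unfolding R_def using CR Cauchy_convergent convergent_LIMSEQ_iff by blast
  have dc: "double_centralizer L R"
    unfolding double_centralizer_def
  proof (intro allI conjI)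
    fix x y
    show "L (x * y) = L x * y"
      using LIMSEQ_unique[OF L[of "x * y"]] tendsto_mult[OF L[of x] tendsto_const[of y]]
      by (simp add: lmult_times)
    show "R (x * y) = x * R y"
      using LIMSEQ_unique[OF R[of "x * y"]] tendsto_mult[OF tendsto_const[of x] R[of y]]
      by (simp add: rmult_times)
    show "x * L y = R x * y"
      using LIMSEQ_unique[OF tendsto_mult[OF tendsto_const[of x] L[of y]]]
        tendsto_mult[OF R[of x] tendsto_const[of y]]
      by (simp add: times_lmult)
  qed
  define Y where "Y = mk_multiplier L R"
  have Y: "lmult Y = L" unfolding Y_def by (rule lmult_mk[OF dc])
  have "X \<longlonglongrightarrow> Y"
  proof (rule LIMSEQ_I)
    fix e :: real assume e: "e > 0"
    then obtain M where M: "\<And>m n. m \<ge> M \<Longrightarrow> n \<ge> M \<Longrightarrow> norm (X m - X n) < e / 2"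
      using X unfolding Cauchy_def dist_norm by (metis half_gt_zero)
    have "norm (X n - Y) < e" if n: "n \<ge> M" for n
    proof -
      have "norm (X n - Y) \<le> e / 2"
      proof (rule norm_multiplier_bound)
        fix x
        have lim: "(\<lambda>k. norm (lmult (X n) x - lmult (X k) x)) \<longlonglongrightarrow> norm (lmult (X n) x - L x)"
          by (intro tendsto_intros L)
        have "norm (lmult (X n) x - lmult (X k) x) \<le> e / 2 * norm x" if "k \<ge> M" for k
        proof -
          have "norm (lmult (X n - X k) x) \<le> norm (X n - X k) * norm x" by (rule norm_lmult_le)
          also have "\<dots> \<le> e / 2 * norm x" using M[OF n that] by (intro mult_right_mono) auto
          finally show ?thesis by simp
        qed
        then have "norm (lmult (X n) x - L x) \<le> e / 2 * norm x"
          by (intro LIMSEQ_le_const2[OF lim]) blast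
        then show "norm (lmult (X n - Y) x) \<le> e / 2 * norm x" by (simp add: Y)
      qed (use e in simp)
      then show ?thesis using e by simp
    qed
    then show "\<exists>M. \<forall>n\<ge>M. norm (X n - Y) < e" by blast
  qed
  then show "convergent X" by (rule convergentI)
qed

instantiation multiplier :: (cstar_algebra) complex_banach_algebra
begin

definition "scaleC c m = mk_multiplier (\<lambda>x. scaleC c (lmult m x)) (\<lambda>x. scaleC c (rmult m (x::'a)))"

lemma dc_scaleC: "double_centralizer (\<lambda>x. scaleC c (lmult m x)) (\<lambda>x. scaleC c (rmult m (x::'a)))"
  by (simp add: double_centralizer_def lmult_times rmult_times times_lmult
      mult_scaleC_left mult_scaleC_right)

lemmas lmult_scaleC_mult [simp] = lmult_mk[OF dc_scaleC, folded scaleC_multiplier_def]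
lemmas rmult_scaleC_mult [simp] = rmult_mk[OF dc_scaleC, folded scaleC_multiplier_def]

instance
proof
  fix m n :: "'a multiplier" and z w :: complex and r :: real
  show "scaleC z (m + n) = scaleC z m + scaleC z n"
    by (rule multiplier_eqI) (simp add: scaleC_add_right)
  show "scaleC (z + w) m = scaleC z m + scaleC w m"
    by (rule multiplier_eqI) (simp add: scaleC_add_left)
  show "scaleC z (scaleC w m) = scaleC (z * w) m"
    by (rule multiplier_eqI) (simp add: scaleC_scaleC)
  show "scaleC (of_real r) m = scaleR r m"
    by (rule multiplier_eqI) (simp add: scaleC_of_real)
  show "scaleC z m * n = scaleC z (m * n)" by (rule multiplier_eqI) simp
  show "m * scaleC z n = scaleC z (m * n)" by (rule multiplier_eqI) (simp add: lmult_scaleC)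
  have le: "norm (scaleC c k) \<le> norm c * norm k" for c and k :: "'a multiplier"
    by (rule norm_multiplier_bound)
      (auto simp: norm_scaleC mult.assoc intro!: mult_left_mono norm_lmult_le)
  have one: "scaleC 1 m = m"
    by (rule multiplier_eqI) (use scaleC_of_real[of 1] in simp)
  show "norm (scaleC z m) = norm z * norm m"
  proof (cases "z = 0")
    case True
    then show ?thesis using le[of 0 m] by simp
  next
    case False
    have "scaleC (inverse z) (scaleC z m) = scaleC 1 m"
      by (rule multiplier_eqI) (use False in \<open>simp add: scaleC_scaleC\<close>)
    then have "scaleC (inverse z) (scaleC z m) = m" by (simp only: one)
    then have "norm m \<le> norm (inverse z) * norm (scaleC z m)" by (metis le)
    then have "norm z * norm m \<le> norm z * (norm (inverse z) * norm (scaleC z m))"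
      by (rule mult_left_mono) simp
    also have "\<dots> = norm (scaleC z m)" using False by (simp add: norm_inverse)
    finally have "norm z * norm m \<le> norm (scaleC z m)" .
    then show ?thesis using le[of z m] by simp
  qed
qed

end

instantiation multiplier :: (cstar_algebra) cstar_algebra
begin

definition "star m = mk_multiplier (\<lambda>x. star (rmult m (star x))) (\<lambda>x. star (lmult m (star (x::'a))))"

lemma dc_star: "double_centralizer (\<lambda>x. star (rmult m (star x))) (\<lambda>x. star (lmult m (star (x::'a))))"
proof -
  have "x * star (rmult m (star y)) = star (lmult m (star x)) * y" for x y
    by (metis star_mult star_star times_lmult)
  then show ?thesis
    by (simp add: double_centralizer_def star_mult lmult_times rmult_times star_star)
qed

lemmas lmult_star [simp] = lmult_mk[OF dc_star, folded star_multiplier_def]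
lemmas rmult_star [simp] = rmult_mk[OF dc_star, folded star_multiplier_def]

instance
proof
  fix m n :: "'a multiplier" and z :: complex
  show ss: "star (star m) = m" for m :: "'a multiplier" by (rule multiplier_eqI) (simp add: star_star)
  show "star (m + n) = star m + star n" by (rule multiplier_eqI) (simp add: star_add)
  show "star (scaleC z m) = scaleC (cnj z) (star m)"
    by (rule multiplier_eqI) (simp add: star_scaleC)
  show "star (m * n) = star n * star m" by (rule multiplier_eqI) (simp add: star_star)
  have ns: "norm (star k) \<le> norm k" for k :: "'a multiplier"
    by (rule norm_multiplier_bound) (use norm_rmult_le[of k "star _"] in auto)
  have up: "norm (star m * m) \<le> (norm m)\<^sup>2"
    using norm_mult_ineq[of "star m" m] mult_right_mono[OF ns[of m], of "norm m"]
    by (simp add: power2_eq_square)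
  have "norm m \<le> sqrt (norm (star m * m))"
  proof (rule norm_multiplier_bound)
    fix x
    have "star x * lmult (star m * m) x = star (lmult m x) * lmult m x"
      by (simp add: times_lmult) (metis star_star times_lmult star_mult rmult_star)
    then have "(norm (lmult m x))\<^sup>2 = norm (star x * lmult (star m * m) x)"
      by (simp only: cstar_identity)
    also have "\<dots> \<le> norm (star x) * norm (lmult (star m * m) x)" by (rule norm_mult_ineq)
    also have "\<dots> \<le> norm x * (norm (star m * m) * norm x)"
      using norm_lmult_le[of "star m * m" x] by (simp add: mult_left_mono)
    also have "\<dots> = (sqrt (norm (star m * m)) * norm x)\<^sup>2"
      by (simp add: power_mult_distrib power2_eq_square)
    finally show "norm (lmult m x) \<le> sqrt (norm (star m * m)) * norm x"
      by (rule power2_le_imp_le) simp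
  qed simp
  then have "(norm m)\<^sup>2 \<le> norm (star m * m)"
    using power_mono[of "norm m" "sqrt (norm (star m * m))" 2] by simp
  with up show "norm (star m * m) = (norm m)\<^sup>2" by simp
qed

end

text \<open>The canonical embedding of a C*-algebra in its multiplier algebra.\<close>

definition embed :: "'a::cstar_algebra \<Rightarrow> 'a multiplier"
  where "embed c = mk_multiplier (\<lambda>x. c * x) (\<lambda>x. x * c)"

lemma dc_embed: "double_centralizer (\<lambda>x. c * x) (\<lambda>x. x * (c::'a::cstar_algebra))"
  by (simp add: double_centralizer_def mult.assoc)

lemma lmult_embed [simp]: "lmult (embed c) x = c * x"
  and rmult_embed [simp]: "rmult (embed c) x = x * c"
  by (simp_all add: embed_def lmult_mk[OF dc_embed] rmult_mk[OF dc_embed])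


section \<open>C*-Segal algebras and weighted C*-algebras\<close>

locale cstar_segal_algebra =
  fixes \<iota> :: "'a::complex_banach_algebra \<Rightarrow> 'c::cstar_algebra"
  assumes hom_add: "\<iota> (a + b) = \<iota> a + \<iota> b"
    and hom_scaleC: "\<iota> (scaleC z a) = scaleC z (\<iota> a)"
    and hom_mult: "\<iota> (a * b) = \<iota> a * \<iota> b"
    and hom_inj: "inj \<iota>"
    and hom_continuous: "continuous_on UNIV \<iota>"
    and dense_range: "closure (range \<iota>) = UNIV"
    and left_ideal: "c * \<iota> a \<in> range \<iota>"
    and right_ideal: "\<iota> a * c \<in> range \<iota>"

text \<open>The second assumption is the standing convention on the norm of the algebra.\<close>

locale self_adjoint_cstar_segal_algebra = cstar_segal_algebra +
  assumes star_closed: "star (\<iota> a) \<in> range \<iota>"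
    and norm_isometric_star: "\<iota> b = star (\<iota> a) \<Longrightarrow> norm b = norm a"

text \<open>
  Products of elements of the algebra with elements of \<open>C\<close> are taken in \<open>C\<close>, so the
  bimodule conditions read \<open>\<pi>(ca) = c\<pi>(a)\<close> and \<open>\<pi>(ac) = \<pi>(a)c\<close>.
\<close>

locale weighted_cstar_algebra = self_adjoint_cstar_segal_algebra \<iota>
  for \<iota> :: "'a::complex_banach_algebra \<Rightarrow> 'c::cstar_algebra" +
  fixes \<pi> :: "'a \<Rightarrow> 'c multiplier"
  assumes pi_add: "\<pi> (a + b) = \<pi> a + \<pi> b"
    and pi_scaleC: "\<pi> (scaleC z a) = scaleC z (\<pi> a)"
    and pi_left: "\<iota> b = c * \<iota> a \<Longrightarrow> \<pi> b = embed c * \<pi> a"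
    and pi_right: "\<iota> b = \<iota> a * c \<Longrightarrow> \<pi> b = \<pi> a * embed c"
    and pi_positive: "positive (\<iota> a) \<Longrightarrow> positive (\<pi> a)"
    and pi_isometric: "norm (\<pi> a) = norm a"


section \<open>The approximate ideal and the multipliers into the algebra\<close>

definition multiplier_norm :: "'a::real_normed_algebra \<Rightarrow> real"
  where "multiplier_norm a =
    Sup ({norm (a * b) |b. norm b \<le> 1} \<union> {norm (b * a) |b. norm b \<le> 1})"

definition multiplier_Cauchy :: "(nat \<Rightarrow> 'a::real_normed_algebra) \<Rightarrow> bool"
  where "multiplier_Cauchy X \<longleftrightarrow>
    (\<forall>e>0. \<exists>N. \<forall>m\<ge>N. \<forall>n\<ge>N. multiplier_norm (X m - X n) < e)"

text \<open>
  The completion of the algebra in the multiplier norm consists of the classes \<open>[X]\<close> of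
  Cauchy sequences modulo null sequences, with \<open>a[X] = [aX]\<close>; an element \<open>y\<close> of the algebra
  is the class of the constant sequence \<open>y\<close>.  Hence \<open>y = a[X]\<close> means that \<open>aX - y\<close> is a
  null sequence for the multiplier norm.
\<close>

definition approximate_ideal :: "'a::real_normed_algebra set"
  where "approximate_ideal =
    {y. \<exists>a X. multiplier_Cauchy X \<and> (\<lambda>n. multiplier_norm (a * X n - y)) \<longlonglongrightarrow> 0}"

definition C_multiplier_pairs ::
    "('a::complex_banach_algebra \<Rightarrow> 'c::cstar_algebra) \<Rightarrow> (('c \<Rightarrow> 'a) \<times> ('c \<Rightarrow> 'a)) set"
  where "C_multiplier_pairs \<iota> = {(ml, mr). \<forall>x y.
    \<iota> (ml (x * y)) = \<iota> (ml x) * y \<and> \<iota> (mr (x * y)) = x * \<iota> (mr y) \<and>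
    x * \<iota> (ml y) = \<iota> (mr x) * y}"

definition C_multipliers ::
    "('a::complex_banach_algebra \<Rightarrow> 'c::cstar_algebra) \<Rightarrow> 'c multiplier set"
  where "C_multipliers \<iota> =
    {m. \<exists>(ml, mr) \<in> C_multiplier_pairs \<iota>. lmult m = \<iota> \<circ> ml \<and> rmult m = \<iota> \<circ> mr}"

end

theory Submission
  imports Defs
begin

text \<open>
  Completeness of \<open>A\<close> makes \<open>\<pi>(A)\<close> closed in \<open>M(C)\<close>, so \<open>J = C \<inter> \<pi>(A)\<close> is a closed ideal of
  \<open>C\<close>. If \<open>\<pi>(a) = y z\<close> with \<open>y, z \<in> J\<close> and \<open>z = \<pi>(b)\<close>, then \<open>a = y b \<in> J\<close>; since elements of a
  closed ideal factor inside the ideal, \<open>J\<close> contains \<open>A C\<close>, which is dense, and \<open>C \<subseteq> \<pi>(A)\<close>. Hence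
  \<open>\<pi>\<^sup>-\<^sup>1\<close> restricts to a bimodule map \<open>C \<rightarrow> A \<subseteq> C\<close>, which is multiplication by a central multiplier
  \<open>u\<close> with \<open>a = u \<pi>(a)\<close>. Positivity of \<open>\<pi>\<close> forces \<open>u\<close> to be self-adjoint and its negative part to
  vanish. In place of a functional calculus, roots come from binomial series.
\<close>

section \<open>Binomial series\<close>

text \<open>The coefficient of \<open>x^n\<close> in the power series of \<open>(1 - x)^a\<close>.
  With this sign the coefficients for exponents between -1 and 0 are nonnegative.\<close>

definition binom_coeff :: "real \<Rightarrow> nat \<Rightarrow> real"
  where "binom_coeff a n = (-1) ^ n * (a gchoose n)"

lemma binom_coeff_Suc: "binom_coeff a (Suc n) = binom_coeff a n * (real n - a) / (real n + 1)"
  by (simp add: binom_coeff_def gbinomial_prod_rev field_simps)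

lemma binom_coeff_0 [simp]: "binom_coeff a 0 = 1"
  by (simp add: binom_coeff_def)

lemma binom_coeff_neg_one: "binom_coeff (-1) n = 1"
  by (induction n) (simp_all add: binom_coeff_Suc)

lemma binom_coeff_one: "n \<ge> 2 \<Longrightarrow> binom_coeff 1 n = 0"
  by (induction n rule: dec_induct) (simp_all add: binom_coeff_Suc numeral_2_eq_2)

lemma binom_coeff_Vandermonde:
  "(\<Sum>k\<le>n. binom_coeff a k * binom_coeff b (n - k)) = binom_coeff (a + b) n"
proof -
  have "binom_coeff a k * binom_coeff b (n - k) = (-1) ^ n * ((a gchoose k) * (b gchoose (n - k)))"
    if "k \<le> n" for k
    using that power_add[of "-1::real" k "n - k"] by (simp add: binom_coeff_def mult_ac)
  then have "(\<Sum>k\<le>n. binom_coeff a k * binom_coeff b (n - k)) =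
      (\<Sum>k\<le>n. (-1) ^ n * ((a gchoose k) * (b gchoose (n - k))))" by (intro sum.cong) auto
  then show ?thesis
    by (simp add: binom_coeff_def gbinomial_Vandermonde[symmetric] sum_distrib_left atLeast0AtMost)
qed

text \<open>Consecutive coefficients have quotient \<open>1 + (b - 1)/(n + 1)\<close>. By
  \<open>1 + t \<le> exp t\<close> and \<open>ln (1 + t) \<le> t\<close> it is at most
  \<open>((n + 2)/(n + 1)) powr (b - 1)\<close>, the quotient of the bounds.\<close>

lemma binom_coeff_neg_bounds:
  assumes "0 < b" "b < 1"
  shows "0 \<le> binom_coeff (- b) n \<and> binom_coeff (- b) n \<le> (real n + 1) powr (b - 1)"
proof (induction n)
  case (Suc n)
  have "(real n + b) / (real n + 1) = 1 + (b - 1) / (real n + 1)" by (simp add: field_simps)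
  also have "\<dots> \<le> exp ((b - 1) / (real n + 1))" by (rule exp_ge_add_one_self)
  also have "\<dots> \<le> exp ((b - 1) * ln (1 + 1 / (real n + 1)))"
    using ln_add_one_self_le_self[of "1 / (real n + 1)"] assms
      mult_left_mono_neg[of "ln (1 + 1 / (real n + 1))" "1 / (real n + 1)" "b - 1"] by simp
  also have "\<dots> = exp ((b - 1) * (ln (real n + 2) - ln (real n + 1)))"
  proof -
    have "1 + 1 / (real n + 1) = (real n + 2) / (real n + 1)" by (simp add: field_simps)
    then show ?thesis by (simp add: ln_div)
  qed
  also have "\<dots> = (real n + 2) powr (b - 1) / (real n + 1) powr (b - 1)"
    by (simp add: powr_def exp_diff[symmetric] algebra_simps)
  finally have le: "(real n + b) / (real n + 1) \<le> \<dots>" .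
  have "binom_coeff (- b) (Suc n) = binom_coeff (- b) n * ((real n + b) / (real n + 1))"
    by (simp add: binom_coeff_Suc)
  moreover have "\<dots> \<le> (real n + 1) powr (b - 1) *
      ((real n + 2) powr (b - 1) / (real n + 1) powr (b - 1))"
    using Suc assms le by (intro mult_mono) auto
  ultimately show ?case using Suc assms by (simp add: add_ac)
qed simp

lemma summable_Suc_powr: "p < -1 \<Longrightarrow> summable (\<lambda>n. (real n + 1) powr p)"
  using summable_iff_shift[of "\<lambda>n. real n powr p" 1] by (simp add: summable_real_powr_iff add_ac)

text \<open>The absorption identity reduces \<open>a\<close> to the exponent
  \<open>- (1 - a)\<close> bounded above and gives decay of order \<open>n powr (- a - 1)\<close>.
  Absolute summability makes the series usable for all \<open>q\<close> of norm at most 1.\<close>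

lemma summable_binom_coeff:
  assumes "0 < a" "a < 1"
  shows "summable (\<lambda>n. \<bar>binom_coeff a n\<bar>)"
proof -
  have eq: "binom_coeff a (Suc n) = - (a / (real n + 1)) * binom_coeff (- (1 - a)) n" for n
  proof -
    have "(a gchoose Suc n) = a / (real n + 1) * (a - 1 gchoose n)"
      using gbinomial_absorption[of n a] by (simp add: field_simps)
    then show ?thesis by (simp add: binom_coeff_def)
  qed
  have "\<bar>binom_coeff a (Suc n)\<bar> \<le> a * (real n + 1) powr (- a - 1)" for n
  proof -
    have "\<bar>binom_coeff a (Suc n)\<bar> = (a / (real n + 1)) * binom_coeff (- (1 - a)) n"
      using binom_coeff_neg_bounds[of "1 - a" n] assms by (simp add: eq abs_mult)
    also have "\<dots> \<le> (a / (real n + 1)) * (real n + 1) powr (- a)"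
      using binom_coeff_neg_bounds[of "1 - a" n] assms by (intro mult_left_mono) auto
    also have "\<dots> = a * (real n + 1) powr (- a - 1)" by (simp add: powr_diff)
    finally show ?thesis .
  qed
  then have "summable (\<lambda>n. \<bar>binom_coeff a (Suc n)\<bar>)"
    using summable_comparison_test'[of "\<lambda>n. a * (real n + 1) powr (- a - 1)" 0
        "\<lambda>n. \<bar>binom_coeff a (Suc n)\<bar>"] summable_mult[OF summable_Suc_powr[of "- a - 1"], of a] assms
    by simp
  then show ?thesis using summable_Suc_iff[of "\<lambda>n. \<bar>binom_coeff a n\<bar>"] by blast
qed

section \<open>Positivity in unital C*-algebras\<close>

lemma scaleC_minus_left: "scaleC (- z) x = - scaleC z (x::'a::complex_banach_algebra)"
proof -
  have "scaleC 0 x = 0" using scaleC_of_real[of 0 x] by simp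
  then show ?thesis using scaleC_add_left[of "- z" z x] by (simp add: eq_neg_iff_add_eq_0)
qed

lemma scaleC_scaleR: "scaleC z (r *\<^sub>R x) = r *\<^sub>R scaleC z (x::'a::complex_banach_algebra)"
  by (simp add: scaleC_of_real[symmetric] scaleC_scaleC mult.commute)

lemma bounded_linear_star: "bounded_linear (star :: 'a::cstar_algebra \<Rightarrow> 'a)"
  by (rule bounded_linear_intro[where K = 1]) (simp_all add: star_add star_scaleR)

lemma norm_hermitian_square: "star k = k \<Longrightarrow> norm (k * k) = (norm (k::'a::cstar_algebra))\<^sup>2"
  using cstar_identity[of k] by simp

text \<open>The element \<open>w = k + i s\<close> satisfies \<open>w\<^sup>* w = k\<^sup>2 + s\<^sup>2\<close> and has real part \<open>k\<close>.\<close>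

lemma norm_square_le_sum_squares:
  fixes k s :: "'a::cstar_algebra"
  assumes "star k = k" "star s = s" "k * s = s * k"
  shows "(norm k)\<^sup>2 \<le> norm (k * k + s * s)"
proof -
  define w where "w = k + scaleC \<i> s"
  have sw: "star w = k - scaleC \<i> s"
    by (simp add: w_def star_add star_scaleC assms scaleC_minus_left)
  have ii: "scaleC \<i> (scaleC \<i> y) = - y" for y :: 'a
    using scaleC_of_real[of "-1" y] by (simp add: scaleC_scaleC)
  have "star w * w = k * k + s * s"
    unfolding sw unfolding w_def
    by (simp add: algebra_simps mult_scaleC_left mult_scaleC_right scaleC_add_right
        scaleC_minus_right assms ii)
  then have nw: "(norm w)\<^sup>2 = norm (k * k + s * s)" using cstar_identity[of w] by simp
  have "2 *\<^sub>R k = w + star w" unfolding sw by (simp add: w_def scaleR_2)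
  then have "norm (2 *\<^sub>R k) \<le> norm w + norm (star w)" by (metis norm_triangle_ineq)
  then have "norm k \<le> norm w" by simp
  then show ?thesis unfolding nw[symmetric] by (simp add: power_mono)
qed

section \<open>Roots of \<open>1 - q\<close> in a unital C*-algebra\<close>

class unital_cstar_algebra = cstar_algebra + monoid_mult

lemma star_one [simp]: "star 1 = (1::'a::unital_cstar_algebra)"
  by (metis mult_1_left mult_1_right star_mult star_star)

lemma norm_one_le: "norm (1::'a::unital_cstar_algebra) \<le> 1"
proof -
  have "norm (1::'a) = (norm (1::'a))\<^sup>2" using cstar_identity[of "1::'a"] by simp
  then show ?thesis by (auto simp: power2_eq_square)
qed

lemma norm_power_le_one:
  fixes q :: "'a::unital_cstar_algebra"
  assumes "norm q \<le> 1" shows "norm (q ^ n) \<le> 1"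
proof (induction n)
  case (Suc n)
  then have "norm q * norm (q ^ n) \<le> 1" using assms by (simp add: mult_le_one)
  then show ?case using norm_mult_ineq[of q "q ^ n"] by simp
qed (simp add: norm_one_le)

lemma star_power: "star (q ^ n) = (star q::'a::unital_cstar_algebra) ^ n"
  by (induction n) (simp_all add: star_mult power_commutes)

lemma commute_mult:
  fixes t :: "'a::semigroup_mult"
  assumes "t * a = a * t" "t * b = b * t" shows "t * (a * b) = (a * b) * t"
proof -
  have "t * (a * b) = (a * t) * b" by (simp only: mult.assoc[symmetric] assms)
  then show ?thesis by (simp add: mult.assoc assms)
qed

lemma power_commute:
  fixes t :: "'a::monoid_mult"
  assumes "t * q = q * t" shows "t * q ^ n = q ^ n * t"
  by (induction n) (simp_all add: assms mult.assoc[symmetric], simp add: assms mult.assoc)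

definition binom_series :: "real \<Rightarrow> 'a::unital_cstar_algebra \<Rightarrow> 'a"
  where "binom_series a q = (\<Sum>n. binom_coeff a n *\<^sub>R q ^ n)"

context
  fixes q :: "'a::unital_cstar_algebra" and a :: real
  assumes q: "norm q \<le> 1" and a: "0 < a" "a < 1"
begin

lemma summable_norm_binom_series: "summable (\<lambda>n. norm (binom_coeff a n *\<^sub>R q ^ n))"
  by (rule summable_comparison_test'[OF summable_binom_coeff[OF a], of 0])
    (simp add: mult_left_le norm_power_le_one[OF q])

lemma summable_binom_series: "summable (\<lambda>n. binom_coeff a n *\<^sub>R q ^ n)"
  using summable_norm_binom_series by (rule summable_norm_cancel)

lemma binom_series_commute: "t * q = q * t \<Longrightarrow> t * binom_series a q = binom_series a q * t"
  unfolding binom_series_def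
  by (simp add: suminf_mult[symmetric] suminf_mult2 summable_binom_series power_commute)

lemma star_binom_series: "star q = q \<Longrightarrow> star (binom_series a q) = binom_series a q"
  unfolding binom_series_def
  by (simp add: bounded_linear.suminf[OF bounded_linear_star summable_binom_series]
      star_scaleR star_power)

end

lemma binom_series_mult:
  fixes q :: "'a::unital_cstar_algebra"
  assumes "norm q \<le> 1" "0 < a" "a < 1" "0 < b" "b < 1"
  shows "binom_series a q * binom_series b q = binom_series (a + b) q"
proof -
  have "(\<Sum>i\<le>n. binom_coeff a i *\<^sub>R q ^ i * binom_coeff b (n - i) *\<^sub>R q ^ (n - i)) =
      binom_coeff (a + b) n *\<^sub>R q ^ n" for n
    by (simp add: binom_coeff_Vandermonde[symmetric] scaleR_sum_left power_add[symmetric] mult_ac)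
  then show ?thesis
    using Cauchy_product_sums[OF summable_norm_binom_series summable_norm_binom_series, of q a q b]
      assms by (simp add: binom_series_def sums_iff)
qed

lemma binom_series_one: "binom_series 1 q = 1 - (q::'a::unital_cstar_algebra)"
proof -
  have "(\<Sum>n. binom_coeff 1 n *\<^sub>R q ^ n) = (\<Sum>n\<in>{0, 1}. binom_coeff 1 n *\<^sub>R q ^ n)"
    by (rule suminf_finite) (auto simp: binom_coeff_one)
  then show ?thesis by (simp add: binom_series_def binom_coeff_Suc)
qed

text \<open>\<open>s\<close> lies in the bicommutant of \<open>q\<close>. The roots below have this
  property, which replaces the commutation rules of a functional calculus.\<close>

definition bicommutes :: "'a::times \<Rightarrow> 'a \<Rightarrow> bool"
  where "bicommutes q s \<longleftrightarrow> (\<forall>t. t * q = q * t \<longrightarrow> t * s = s * t)"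

lemma bicommutesD: "bicommutes q s \<Longrightarrow> t * q = q * t \<Longrightarrow> t * s = s * t"
  by (simp add: bicommutes_def)

lemma fourth_root_one_minus:
  fixes q :: "'a::unital_cstar_algebra"
  assumes "star q = q" "norm q \<le> 1"
  obtains e where "star e = e" "(e * e) * (e * e) = 1 - q" "bicommutes q e"
proof (rule that[of "binom_series (1/4) q"])
  have "binom_series (1/4) q * binom_series (1/4) q = binom_series (1/2) q"
    using binom_series_mult[of q "1/4" "1/4"] assms by simp
  moreover have "binom_series (1/2) q * binom_series (1/2) q = 1 - q"
    using binom_series_mult[of q "1/2" "1/2"] assms by (simp add: binom_series_one)
  ultimately show "(binom_series (1/4) q * binom_series (1/4) q) *
      (binom_series (1/4) q * binom_series (1/4) q) = 1 - q" by simp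
  show "bicommutes q (binom_series (1/4) q)"
    unfolding bicommutes_def by (intro allI impI binom_series_commute assms) simp_all
  show "star (binom_series (1/4) q) = binom_series (1/4) q"
    by (rule star_binom_series[OF assms(2) _ _ assms(1)]) simp_all
qed

lemma sqrt_one_minus:
  fixes q :: "'a::unital_cstar_algebra"
  assumes "star q = q" "norm q \<le> 1"
  obtains s where "star s = s" "s * s = 1 - q" "bicommutes q s"
proof -
  obtain e where e: "star e = e" "(e * e) * (e * e) = 1 - q" "bicommutes q e"
    using fourth_root_one_minus[OF assms] by blast
  have "bicommutes q (e * e)"
    unfolding bicommutes_def by (intro allI impI commute_mult bicommutesD[OF e(3)])
  then show thesis by (intro that[of "e * e"] e(2)) (simp_all add: star_mult e(1))
qed

section \<open>Order estimates through squares of hermitian elements\<close>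

lemma norm_hermitian_square_le:
  fixes k :: "'a::cstar_algebra"
  assumes "star k = k" "norm k \<le> 1" shows "norm (k * k) \<le> 1"
  using assms by (simp add: norm_hermitian_square power_le_one)

text \<open>With \<open>s\<close> a square root of \<open>1 - k * k\<close>, both bounds come from
  sums of squares equal to 1: \<open>k\<^sup>2 + s\<^sup>2\<close> and, as for the double angle,
  \<open>(1 - 2 k\<^sup>2)\<^sup>2 + (2 k s)\<^sup>2\<close>.\<close>

lemma norm_one_minus_square_le:
  fixes k :: "'a::unital_cstar_algebra"
  assumes k: "star k = k" "norm k \<le> 1"
  shows "norm (1 - k * k) \<le> 1" and "norm (1 - 2 *\<^sub>R (k * k)) \<le> 1"
proof -
  have "star (k * k) = k * k" by (simp add: star_mult k)
  then obtain s where s: "star s = s" "s * s = 1 - k * k"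
      "bicommutes (k * k) s"
    using sqrt_one_minus[OF _ norm_hermitian_square_le[OF k]] by blast
  have ks: "k * s = s * k" by (rule bicommutesD[OF s(3)]) (simp add: mult.assoc)
  have "(norm s)\<^sup>2 \<le> norm (s * s + k * k)"
    by (rule norm_square_le_sum_squares) (simp_all add: s k ks)
  also have "\<dots> \<le> 1" using norm_one_le[where 'a = 'a] by (simp add: s)
  finally show "norm (1 - k * k) \<le> 1" using norm_hermitian_square[OF s(1)] by (simp add: s)
  have cc: "(1 - 2 *\<^sub>R (k * k)) * (k * s) = (k * s) * (1 - 2 *\<^sub>R (k * k))"
    by (simp add: algebra_simps ks) (metis ks mult.assoc)
  have "(k * s) * (k * s) = k * k * (s * s)" by (metis ks mult.assoc)
  then have kss: "(k * s) * (k * s) = k * k - (k * k) * (k * k)"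
    by (simp add: s right_diff_distrib)
  have "(1 - 2 *\<^sub>R (k * k)) * (1 - 2 *\<^sub>R (k * k)) + (2 *\<^sub>R (k * s)) * (2 *\<^sub>R (k * s)) =
      1 - 2 *\<^sub>R (k * k) - 2 *\<^sub>R (k * k) + 4 *\<^sub>R (k * k)"
    by (simp only: mult_scaleR_left mult_scaleR_right kss) (simp add: algebra_simps)
  also have "\<dots> = 1" by (simp flip: scaleR_diff_left scaleR_add_left add: algebra_simps)
  finally have "(1 - 2 *\<^sub>R (k * k)) * (1 - 2 *\<^sub>R (k * k)) + (2 *\<^sub>R (k * s)) * (2 *\<^sub>R (k * s)) = 1" .
  moreover have "(norm (1 - 2 *\<^sub>R (k * k)))\<^sup>2 \<le>
      norm ((1 - 2 *\<^sub>R (k * k)) * (1 - 2 *\<^sub>R (k * k)) + (2 *\<^sub>R (k * s)) * (2 *\<^sub>R (k * s)))"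
    by (rule norm_square_le_sum_squares)
      (simp_all only: star_diff star_one star_scaleR star_mult s(1) k(1) ks[symmetric] cc
        mult_scaleR_left mult_scaleR_right)
  ultimately have "(norm (1 - 2 *\<^sub>R (k * k)))\<^sup>2 \<le> 1"
    using norm_one_le[where 'a = 'a] by simp
  then show "norm (1 - 2 *\<^sub>R (k * k)) \<le> 1" by (simp add: abs_square_le_1)
qed

text \<open>After scaling by \<open>2 c\<^sup>2\<close>, the element \<open>1 - p\<close> is the
  mean of two contractions of the form \<open>1 - k\<^sup>2\<close>, so \<open>p\<close> has a
  square root.\<close>

lemma sum_squares_is_square:
  fixes k l :: "'a::unital_cstar_algebra"
  assumes kl: "star k = k" "star l = l"
  obtains m where "star m = m" "m * m = k * k + l * l"
    "bicommutes (k * k + l * l) m"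
proof -
  define c where "c = norm k + norm l + 1"
  have c: "c > 0" "norm k \<le> c" "norm l \<le> c" by (auto simp: c_def add_nonneg_pos)
  define p where "p = (1 / (2 * c\<^sup>2)) *\<^sub>R (k * k + l * l)"
  have "1 - p = (1/2) *\<^sub>R ((1 - ((1/c) *\<^sub>R k) * ((1/c) *\<^sub>R k)) + (1 - ((1/c) *\<^sub>R l) * ((1/c) *\<^sub>R l)))"
    by (simp add: p_def algebra_simps power2_eq_square) (simp flip: scaleR_add_left)
  moreover have "norm (1 - ((1/c) *\<^sub>R k) * ((1/c) *\<^sub>R k)) \<le> 1"
      "norm (1 - ((1/c) *\<^sub>R l) * ((1/c) *\<^sub>R l)) \<le> 1"
    by (intro norm_one_minus_square_le; use c kl in \<open>simp add: star_scaleR\<close>)+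
  ultimately have n: "norm (1 - p) \<le> 1"
    using norm_triangle_le[of "1 - ((1/c) *\<^sub>R k) * ((1/c) *\<^sub>R k)" "1 - ((1/c) *\<^sub>R l) * ((1/c) *\<^sub>R l)" 2] by (simp only: norm_scaleR) simp
  have sp: "star (1 - p) = 1 - p"
    by (simp add: p_def star_diff star_scaleR star_add star_mult kl)
  obtain s where s: "star s = s" "s * s = 1 - (1 - p)"
      "bicommutes (1 - p) s"
    using sqrt_one_minus[OF sp n] by blast
  show thesis
  proof (rule that[of "(c * sqrt 2) *\<^sub>R s"])
    show "((c * sqrt 2) *\<^sub>R s) * ((c * sqrt 2) *\<^sub>R s) = k * k + l * l"
      using c(1) by (simp add: s p_def power2_eq_square)
  next
    show "bicommutes (k * k + l * l) ((c * sqrt 2) *\<^sub>R s)"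
      unfolding bicommutes_def
    proof (intro allI impI)
      fix t assume "t * (k * k + l * l) = (k * k + l * l) * t"
      then have "t * s = s * t"
        by (intro bicommutesD[OF s(3)]) (simp add: p_def right_diff_distrib left_diff_distrib)
      then show "t * ((c * sqrt 2) *\<^sub>R s) = ((c * sqrt 2) *\<^sub>R s) * t" by simp
    qed
  qed (simp add: star_scaleR s)
qed

text \<open>
  The Kelley--Vaught argument: if \<open>\<parallel>z\<parallel> = 1\<close>, then \<open>z z\<^sup>*\<close> is a square \<open>l\<^sup>2\<close>, so that
  \<open>z\<^sup>* (1 - 2 z z\<^sup>*) z = - k\<^sup>2 - 2 k\<^sup>4\<close> has norm at most 1, although \<open>2 k\<^sup>4\<close> has norm 2.
\<close>

lemma star_mult_eq_minus_square_imp_zero: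
  fixes z k :: "'a::unital_cstar_algebra"
  assumes k: "star k = k" and z: "star z * z = - (k * k)"
  shows "z = 0"
proof (rule ccontr)
  assume "z \<noteq> 0"
  define w where "w = (1 / norm z) *\<^sub>R z"
  define h where "h = (1 / norm z) *\<^sub>R k"
  have nw: "norm w = 1" using \<open>z \<noteq> 0\<close> by (simp add: w_def)
  have h: "star h = h" by (simp add: h_def star_scaleR k)
  have wh: "star w * w = - (h * h)" by (simp add: w_def h_def star_scaleR z)
  \<comment> \<open>Real and imaginary parts of \<open>w\<close> up to sign and scaling, chosen so
    that \<open>x\<^sup>2 + y\<^sup>2 = w * star w + star w * w\<close>. As
    \<open>star w * w = - h\<^sup>2\<close>, this makes \<open>w * star w\<close> a sum of three
    squares.\<close>
  define x where "x = (1 / sqrt 2) *\<^sub>R (w + star w)"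
  define y where "y = scaleC \<i> ((1 / sqrt 2) *\<^sub>R (w - star w))"
  have x: "star x = x" by (simp add: x_def star_scaleR star_add star_star add.commute)
  have y: "star y = y"
    by (simp add: y_def star_scaleR star_scaleC star_diff star_star scaleC_minus_left
        scaleC_minus_right scaleR_diff_right)
  have ii: "scaleC \<i> (scaleC \<i> v) = - v" for v :: 'a
    using scaleC_of_real[of "-1" v] by (simp add: scaleC_scaleC)
  have yy: "y * y = (1 / 2) *\<^sub>R (- ((w - star w) * (w - star w)))"
    by (simp add: y_def mult_scaleC_left mult_scaleC_right scaleC_scaleR ii)
  have xx: "x * x = (1 / 2) *\<^sub>R ((w + star w) * (w + star w))" by (simp add: x_def)
  have "x * x + y * y = (1 / 2) *\<^sub>R (2 *\<^sub>R (w * star w) + 2 *\<^sub>R (star w * w))"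
    unfolding xx yy scaleR_add_right[symmetric] by (simp add: algebra_simps scaleR_2)
  then have sum: "x * x + y * y = w * star w - h * h"
    by (simp add: scaleR_add_right scaleR_diff_right wh)
  obtain m where m: "star m = m" "m * m = x * x + y * y"
    using sum_squares_is_square[OF x y] by blast
  obtain l where l: "star l = l" "l * l = m * m + h * h"
    using sum_squares_is_square[OF m(1) h] by blast
  have ll: "l * l = w * star w" by (simp add: l m sum)
  have "norm l \<le> 1"
    using norm_hermitian_square[OF l(1)] norm_mult_star[of w] by (simp add: ll nw abs_square_eq_1)
  then have "norm (1 - 2 *\<^sub>R (w * star w)) \<le> 1"
    using norm_one_minus_square_le(2)[OF l(1)] by (simp add: ll)
  then have "norm (star w * (1 - 2 *\<^sub>R (w * star w)) * w) \<le> 1"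
    using norm_mult_ineq[of "star w * (1 - 2 *\<^sub>R (w * star w))" w]
      norm_mult_ineq[of "star w" "1 - 2 *\<^sub>R (w * star w)"] by (simp add: nw)
  moreover have "star w * (1 - 2 *\<^sub>R (w * star w)) * w =
      star w * w - 2 *\<^sub>R ((star w * w) * (star w * w))"
    by (simp add: algebra_simps)
  moreover have "\<dots> = - ((sqrt 2 *\<^sub>R (h * h)) * (sqrt 2 *\<^sub>R (h * h)) + h * h)"
    unfolding wh by simp
  ultimately have le: "norm ((sqrt 2 *\<^sub>R (h * h)) * (sqrt 2 *\<^sub>R (h * h)) + h * h) \<le> 1"
    by (simp only: norm_minus_cancel)
  have "(norm (sqrt 2 *\<^sub>R (h * h)))\<^sup>2 \<le> norm ((sqrt 2 *\<^sub>R (h * h)) * (sqrt 2 *\<^sub>R (h * h)) + h * h)"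
    by (rule norm_square_le_sum_squares) (simp_all add: star_scaleR star_mult h mult.assoc)
  moreover have "norm (h * h) = 1" using cstar_identity[of w] by (simp add: wh nw)
  ultimately show False using le by (simp add: power_mult_distrib)
qed

section \<open>Factorization\<close>

text \<open>On scalars this is \<open>(n + 1) t (1 - t)^n \<le> 1\<close> for \<open>t\<close> in
  \<open>[0, 1]\<close>. Here \<open>1 - (n + 1) h\<^sup>2 q^n\<close> is exhibited as a square
  \<open>g\<^sup>2\<close>, and \<open>k\<^sup>2 + g\<^sup>2 = 1\<close> bounds
  \<open>k\<close>.\<close>

lemma norm_hermitian_one_minus_power_le:
  fixes h :: "'a::unital_cstar_algebra"
  assumes h: "star h = h" "norm h \<le> 1"
  shows "norm (h * h * (1 - h * h) ^ n) \<le> 1 / (real n + 1)"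
proof -
  define q where "q = 1 - h * h"
  have hh: "h * h = 1 - q" by (simp add: q_def)
  have "star (h * h) = h * h" by (simp add: star_mult h)
  then obtain s where s: "star s = s" "s * s = q" "bicommutes (h * h) s"
    using sqrt_one_minus[OF _ norm_hermitian_square_le[OF h]] unfolding q_def by blast
  have hs: "h * s = s * h" by (rule bicommutesD[OF s(3)]) (simp add: mult.assoc)
  have s_pow: "s ^ j * s ^ j = q ^ j" for j
    by (metis s(2) power2_eq_square power_mult mult_2 power_add)
  have qs: "q * s ^ j = s ^ j * q" for j
    by (metis power_commutes s(2) mult.assoc)
  have hsj: "h * s ^ j = s ^ j * h" for j by (rule power_commute[OF hs])
  have h2s: "h * h * s ^ j = s ^ j * (h * h)" for j by (metis hsj mult.assoc)
  \<comment> \<open>From \<open>n\<close> to \<open>n + 1\<close> the right-hand side grows by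
    \<open>(n + 1) (1 - q)\<^sup>2 q^n\<close>, a square since \<open>q^n\<close> is the square of
    \<open>s^n\<close>.\<close>
  have D: "\<exists>m. star m = m \<and> m * m = 1 - q ^ Suc n - (real n + 1) *\<^sub>R (h * h * q ^ n)" for n
  proof (induction n)
    case 0
    show ?case by (rule exI[of _ 0]) (simp add: hh)
  next
    case (Suc n)
    then obtain m where m: "star m = m"
      "m * m = 1 - q ^ Suc n - (real n + 1) *\<^sub>R (h * h * q ^ n)" by blast
    define k where "k = sqrt (real n + 1) *\<^sub>R (h * h * s ^ n)"
    have k: "star k = k"
      using h2s[of n] by (simp add: k_def star_scaleR star_mult star_power h s(1))
    have "(h * h * s ^ n) * (h * h * s ^ n) = (h * h) * (h * h) * (s ^ n * s ^ n)"
      by (metis h2s mult.assoc)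
    then have kk: "k * k = (real n + 1) *\<^sub>R ((1 - q) * (1 - q) * q ^ n)"
      by (simp add: k_def s_pow hh)
    have "m * m + k * k = 1 - q ^ Suc (Suc n) - (real (Suc n) + 1) *\<^sub>R (h * h * q ^ Suc n)"
      unfolding m kk hh by (simp add: algebra_simps scaleR_2)
    then show ?case using sum_squares_is_square[OF m(1) k] by metis
  qed
  obtain m where m: "star m = m" "m * m = 1 - q ^ Suc n - (real n + 1) *\<^sub>R (h * h * q ^ n)"
    using D by blast
  have ss: "star (s ^ Suc n) = s ^ Suc n" by (simp only: star_power s(1))
  obtain g where g: "star g = g" "g * g = m * m + s ^ Suc n * s ^ Suc n"
      "bicommutes (m * m + s ^ Suc n * s ^ Suc n) g"
    using sum_squares_is_square[OF m(1) ss] by blast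
  define k where "k = sqrt (real n + 1) *\<^sub>R (h * s ^ n)"
  have k: "star k = k" by (simp add: k_def star_scaleR star_mult star_power h s(1) hsj)
  have "(h * s ^ n) * (h * s ^ n) = (h * h) * (s ^ n * s ^ n)" by (metis hsj mult.assoc)
  then have kk: "k * k = (real n + 1) *\<^sub>R (h * h * q ^ n)" by (simp add: k_def s_pow)
  have one: "g * g = 1 - k * k" unfolding g(2) m s_pow kk by simp
  have kg: "k * g = g * k"
    by (rule bicommutesD[OF g(3)]) (unfold g(2)[symmetric] one, simp add: algebra_simps)
  have "(norm k)\<^sup>2 \<le> norm (k * k + g * g)"
    by (rule norm_square_le_sum_squares[OF k g(1) kg])
  then have "norm (k * k) \<le> 1" using norm_one_le[where 'a = 'a] norm_hermitian_square[OF k]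
    by (simp add: one)
  then have "(real n + 1) * norm (h * h * q ^ n) \<le> 1" unfolding kk norm_scaleR by simp
  then show ?thesis unfolding q_def by (simp add: field_simps)
qed

lemma suminf_in_closed_subspace:
  fixes f :: "nat \<Rightarrow> 'a::real_normed_vector"
  assumes "closed S" "subspace S" "\<And>n. f n \<in> S" "summable f"
  shows "suminf f \<in> S"
proof (rule closed_sequentially[OF assms(1)])
  show "(\<lambda>n. \<Sum>i<n. f i) \<longlonglongrightarrow> suminf f" by (rule summable_LIMSEQ[OF assms(4)])
  show "\<And>n. (\<Sum>i<n. f i) \<in> S" by (intro subspace_sum assms)
qed

text \<open>
  With \<open>h = x\<^sup>* x\<close> and \<open>q = 1 - h\<^sup>2\<close> the factors are \<open>y = x (1 - q)^(-1/8)\<close> and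
  \<open>z = h\<^sup>2 (1 - q)^(-7/8)\<close>, expanded into binomial series in \<open>q\<close>. The decay of \<open>\<parallel>x q\<^sup>n\<parallel>\<close> and
  \<open>\<parallel>h\<^sup>2 q\<^sup>n\<parallel>\<close> makes both series converge absolutely.
\<close>

lemma factorization_contraction:
  fixes x :: "'a::unital_cstar_algebra"
  assumes S: "closed S" "subspace S"
    and x: "x \<in> S" "norm x \<le> 1"
    and h: "star x * x \<in> S" "\<And>s. s \<in> S \<Longrightarrow> s * (star x * x) \<in> S"
  obtains y z where "y \<in> S" "z \<in> S" "x = y * z"
proof -
  define h where "h = star x * x"
  define q where "q = 1 - h * h"
  have sh: "star h = h" by (simp add: h_def star_mult star_star)
  have nh: "norm h \<le> 1" using x(2) by (simp add: h_def cstar_identity power_le_one)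
  have sq: "star q = q" by (simp add: q_def star_diff star_mult sh)
  have hq: "h * q = q * h" by (simp add: q_def algebra_simps)
  have hqn: "h * q ^ n = q ^ n * h" for n by (rule power_commute[OF hq])
  have decay: "norm (h * h * q ^ n) \<le> 1 / (real n + 1)" for n
    unfolding q_def by (rule norm_hermitian_one_minus_power_le[OF sh nh])
  \<comment> \<open>Applying the C*-identity twice gives
    \<open>norm (x q^n) ^ 4 = norm (h\<^sup>2 q^(4 n))\<close>, hence the exponent
    \<open>-1/4\<close>.\<close>
  have xq: "norm (x * q ^ n) \<le> (real n + 1) powr (- 1/4)" for n
  proof -
    define g where "g = h * q ^ (2 * n)"
    have sg: "star g = g" by (simp add: g_def star_mult star_power sh sq hqn)
    have "star (x * q ^ n) * (x * q ^ n) = q ^ n * h * q ^ n"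
      by (simp add: star_mult star_power sq h_def mult.assoc)
    also have "\<dots> = g" by (simp add: g_def hqn[symmetric] mult_2 power_add mult.assoc)
    finally have ng: "(norm (x * q ^ n))\<^sup>2 = norm g" using cstar_identity[of "x * q ^ n"] by simp
    have "norm (x * q ^ n) ^ 4 = ((norm (x * q ^ n))\<^sup>2)\<^sup>2" by (simp flip: power_mult)
    also have "\<dots> = norm (g * g)" unfolding ng by (simp add: norm_hermitian_square[OF sg])
    also have "g * g = h * h * q ^ (4 * n)"
    proof -
      have "g * g = h * (q ^ (2 * n) * h) * q ^ (2 * n)" by (simp add: g_def mult.assoc)
      also have "\<dots> = h * h * (q ^ (2 * n) * q ^ (2 * n))"
        by (simp only: hqn[symmetric] mult.assoc)
      also have "q ^ (2 * n) * q ^ (2 * n) = q ^ (4 * n)" by (simp flip: power_add)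
      finally show ?thesis .
    qed
    also have "norm \<dots> \<le> 1 / (real (4 * n) + 1)" by (rule decay)
    also have "\<dots> \<le> 1 / (real n + 1)" by (intro divide_left_mono) auto
    finally have le: "norm (x * q ^ n) ^ 4 \<le> (real n + 1) powr (- 1)"
      by (simp add: powr_minus divide_inverse)
    have "((real n + 1) powr (- 1/4)) ^ 4 = (real n + 1) powr (- 1)"
      by (simp add: powr_power)
    then show ?thesis using le power_mono_iff[of "norm (x * q ^ n)" "(real n + 1) powr (- 1/4)" 4]
      by simp
  qed
  \<comment> \<open>\<open>S\<close> is only known to be stable under right multiplication by
    \<open>h\<close>, so \<open>q = 1 - h\<^sup>2\<close> is expanded on the right.\<close>
  have xS: "x * q ^ n \<in> S" for n
  proof (induction n)
    case (Suc n)
    have "x * q ^ Suc n = x * q ^ n - (x * q ^ n) * h * h"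
      by (simp add: q_def power_Suc2 algebra_simps del: power_Suc)
    then show ?case using Suc h(2) S(2) by (simp add: subspace_diff h_def)
  qed (simp add: x)
  have hS: "h * h * q ^ n \<in> S" for n
  proof (induction n)
    case (Suc n)
    have "h * h * q ^ Suc n = h * h * q ^ n - (h * h * q ^ n) * h * h"
      by (simp add: q_def power_Suc2 algebra_simps del: power_Suc)
    then show ?case using Suc h(2) S(2) by (simp add: subspace_diff h_def)
  qed (use h(2)[OF h(1)] in \<open>simp add: h_def\<close>)
  define a where "a n = binom_coeff (- (1/8)) n *\<^sub>R (x * q ^ n)" for n
  define b where "b n = binom_coeff (- (7/8)) n *\<^sub>R (h * h * q ^ n)" for n
  \<comment> \<open>The two series are balanced: \<open>1/8 - 1 - 1/4\<close> and
    \<open>7/8 - 1 - 1\<close> both equal \<open>-9/8\<close>.\<close>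
  have sum_a: "summable (\<lambda>n. norm (a n))"
  proof (rule summable_comparison_test'[of "\<lambda>n. (real n + 1) powr (- 9/8)" 0])
    fix n
    have "norm (a n) \<le> (real n + 1) powr (1/8 - 1) * (real n + 1) powr (- 1/4)"
      unfolding a_def norm_scaleR using binom_coeff_neg_bounds[of "1/8" n] xq[of n]
      by (intro mult_mono) auto
    then show "norm (norm (a n)) \<le> (real n + 1) powr (- 9/8)" by (simp flip: powr_add)
  qed (rule summable_Suc_powr, simp)
  have sum_b: "summable (\<lambda>n. norm (b n))"
  proof (rule summable_comparison_test'[of "\<lambda>n. (real n + 1) powr (- 9/8)" 0])
    fix n
    have "norm (b n) \<le> (real n + 1) powr (7/8 - 1) * (1 / (real n + 1))"
      unfolding b_def norm_scaleR using binom_coeff_neg_bounds[of "7/8" n] decay[of n]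
      by (intro mult_mono) auto
    also have "\<dots> = (real n + 1) powr (- 9/8)"
      using powr_diff[of "real n + 1" "- 1/8" 1] by simp
    finally show "norm (norm (b n)) \<le> (real n + 1) powr (- 9/8)" by simp
  qed (rule summable_Suc_powr, simp)
  \<comment> \<open>The exponents \<open>-1/8\<close> and \<open>-7/8\<close> add up to
    \<open>-1\<close>, whose coefficients are all 1. Hence the Cauchy product is the telescoping
    series of \<open>x (1 - q) q^n\<close>.\<close>
  have "(\<Sum>i\<le>n. a i * b (n - i)) = x * q ^ n - x * q ^ Suc n" for n
  proof -
    have "a i * b (n - i) = (binom_coeff (- (1/8)) i * binom_coeff (- (7/8)) (n - i)) *\<^sub>R
        (x * h * h * q ^ n)" if "i \<le> n" for i
    proof -
      have "(x * q ^ i) * (h * h * q ^ (n - i)) = x * h * h * (q ^ i * q ^ (n - i))"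
      proof -
        have "(x * q ^ i) * (h * h * q ^ (n - i)) = x * (q ^ i * h) * h * q ^ (n - i)"
          by (simp only: mult.assoc)
        also have "\<dots> = x * h * (q ^ i * h) * q ^ (n - i)" by (simp only: hqn[symmetric] mult.assoc)
        also have "\<dots> = x * h * h * (q ^ i * q ^ (n - i))"
          by (simp only: hqn[symmetric] mult.assoc)
        finally show ?thesis .
      qed
      also have "q ^ i * q ^ (n - i) = q ^ n" using that by (simp flip: power_add)
      finally show ?thesis by (simp add: a_def b_def)
    qed
    then have "(\<Sum>i\<le>n. a i * b (n - i)) = (\<Sum>i\<le>n. (binom_coeff (- (1/8)) i *
        binom_coeff (- (7/8)) (n - i)) *\<^sub>R (x * h * h * q ^ n))" by (intro sum.cong) auto
    also have "\<dots> = binom_coeff (- (1/8) + - (7/8)) n *\<^sub>R (x * h * h * q ^ n)"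
      by (simp only: binom_coeff_Vandermonde[symmetric] scaleR_sum_left)
    also have "\<dots> = x * (1 - q) * q ^ n" by (simp add: binom_coeff_neg_one q_def mult.assoc)
    finally show ?thesis by (simp add: algebra_simps)
  qed
  then have "(\<lambda>n. x * q ^ n - x * q ^ Suc n) sums (suminf a * suminf b)"
    using Cauchy_product_sums[OF sum_a sum_b] by simp
  moreover have "(\<lambda>n. x * q ^ n - x * q ^ Suc n) sums (x * q ^ 0 - 0)"
  proof (rule telescope_sums', rule Lim_null_comparison)
    show "\<forall>\<^sub>F n in sequentially. norm (x * q ^ n) \<le> (real n + 1) powr (- 1/4)"
      using xq by simp
    show "(\<lambda>n. (real n + 1) powr (- 1/4)) \<longlonglongrightarrow> 0"
      using filterlim_tendsto_add_at_top[OF tendsto_const filterlim_real_sequentially, of 1]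
      by (intro tendsto_neg_powr) (simp_all add: add.commute)
  qed
  ultimately have "x = suminf a * suminf b" using sums_unique2 by fastforce
  moreover have "suminf a \<in> S"
    by (rule suminf_in_closed_subspace[OF S _ summable_norm_cancel[OF sum_a]])
      (simp add: a_def xS subspace_scale[OF S(2)])
  moreover have "suminf b \<in> S"
    by (rule suminf_in_closed_subspace[OF S _ summable_norm_cancel[OF sum_b]])
      (simp add: b_def hS subspace_scale[OF S(2)])
  ultimately show thesis by (intro that)
qed

lemma factorization:
  fixes x :: "'a::unital_cstar_algebra"
  assumes S: "closed S" "subspace S"
    and x: "x \<in> S" "star x * x \<in> S" "\<And>s. s \<in> S \<Longrightarrow> s * (star x * x) \<in> S"
  obtains y z where "y \<in> S" "z \<in> S" "x = y * z"
proof -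
  define c where "c = norm x + 1"
  have c: "c > 0" by (simp add: c_def add_nonneg_pos)
  obtain y z where yz: "y \<in> S" "z \<in> S" "(1 / c) *\<^sub>R x = y * z"
  proof (rule factorization_contraction[OF S, of "(1 / c) *\<^sub>R x"])
    show "norm ((1 / c) *\<^sub>R x) \<le> 1" using c by (simp add: c_def)
  qed (use x S in \<open>auto simp: star_scaleR subspace_scale\<close>)
  have "x = c *\<^sub>R ((1 / c) *\<^sub>R x)" using c by simp
  then have "x = (c *\<^sub>R y) * z" using yz(3) by simp
  then show thesis using yz S by (intro that[of "c *\<^sub>R y" z]) (auto simp: subspace_scale)
qed

section \<open>The multiplier algebra\<close>

instantiation multiplier :: (cstar_algebra) unital_cstar_algebra
begin

definition "1 = mk_multiplier (\<lambda>x. x) (\<lambda>x. x :: 'a)"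

lemma dc_one: "double_centralizer (\<lambda>x. x) (\<lambda>x. x :: 'a)"
  by (simp add: double_centralizer_def)

lemmas lmult_one [simp] = lmult_mk[OF dc_one, folded one_multiplier_def]

instance by standard (auto intro: multiplier_eqI)

end

lemma embed_add: "embed (x + y) = embed x + embed (y::'a::cstar_algebra)"
  and embed_mult: "embed (x * y) = embed x * embed y"
  and embed_scaleR: "embed (r *\<^sub>R x) = r *\<^sub>R embed x"
  and embed_star: "embed (star x) = star (embed x)"
  by (auto intro!: multiplier_eqI simp: distrib_right mult.assoc star_mult star_star)

lemma mult_embed: "m * embed x = embed (lmult m x)"
  by (rule multiplier_eqI) (simp add: lmult_times)

lemma embed_mult_right: "embed x * m = embed (rmult m x)"
  by (rule multiplier_eqI) (simp add: times_lmult)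

lemma norm_embed: "norm (embed x) = norm (x::'a::cstar_algebra)"
proof (rule antisym)
  show "norm (embed x) \<le> norm x"
    by (rule norm_multiplier_bound) (simp_all add: norm_mult_ineq)
  show "norm x \<le> norm (embed x)"
  proof (rule norm_le_right_mult)
    show "norm (x * z) \<le> norm (embed x) * norm z" for z
      using norm_lmult_le[of "embed x" z] by simp
  qed simp
qed

lemma bounded_linear_embed: "bounded_linear embed"
  by (rule bounded_linear_intro[where K = 1]) (simp_all add: embed_add embed_scaleR norm_embed)

lemma embed_inject: "embed x = embed y \<longleftrightarrow> x = (y::'a::cstar_algebra)"
proof
  assume "embed x = embed y"
  then have "x * z = y * z" for z by (metis lmult_embed)
  then show "x = y" by (rule right_faithful)
qed simp

lemma closed_isometric_image:
  fixes f :: "'a::banach \<Rightarrow> 'b::real_normed_vector"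
  assumes "bounded_linear f" "\<And>x. norm (f x) = norm x" "closed S" "subspace S"
  shows "closed (f ` S)"
  using complete_isometric_image[of 1 S f] assms
  by (simp add: complete_eq_closed complete_imp_closed)

text \<open>The series need a unit, so \<open>J\<close> is carried into \<open>M(C)\<close>. Its
  image stays closed because \<open>embed\<close> is isometric.\<close>

lemma ideal_factorization:
  fixes x :: "'a::cstar_algebra"
  assumes J: "closed J" "subspace J" "x \<in> J"
    and ideal: "\<And>c j. j \<in> J \<Longrightarrow> c * j \<in> J" "\<And>c j. j \<in> J \<Longrightarrow> j * c \<in> J"
  obtains y z where "y \<in> J" "z \<in> J" "x = y * z"
proof -
  have "closed (embed ` J)"
    by (rule closed_isometric_image[OF bounded_linear_embed norm_embed J(1,2)])
  moreover have "subspace (embed ` J)"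
    by (rule linear_subspace_image[OF bounded_linear.linear[OF bounded_linear_embed] J(2)])
  moreover have hx: "star (embed x) * embed x = embed (star x * x)"
    by (simp add: embed_mult embed_star)
  moreover have "star (embed x) * embed x \<in> embed ` J"
    using ideal(1)[OF J(3)] unfolding hx by blast
  moreover have "s * (star (embed x) * embed x) \<in> embed ` J" if "s \<in> embed ` J" for s
    using that ideal(2) unfolding hx by (auto simp flip: embed_mult)
  ultimately obtain y z where "y \<in> embed ` J" "z \<in> embed ` J" "embed x = y * z"
    using factorization[of "embed ` J" "embed x"] J(3) by blast
  then show thesis using that by (auto simp: embed_mult[symmetric] embed_inject)
qed

lemma cstar_factorization:
  fixes x :: "'a::cstar_algebra"
  obtains y z where "x = y * z"
  using ideal_factorization[of UNIV x] by auto

lemma star_centre: "u \<in> centre \<Longrightarrow> star u \<in> (centre :: 'a::cstar_algebra set)"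
proof -
  assume "u \<in> centre"
  then have "star (u * star m) = star (star m * u)" for m by (simp add: centre_def)
  then show ?thesis by (simp add: centre_def star_mult star_star)
qed

lemma positive_hermitian: "positive p \<Longrightarrow> star p = p"
  by (auto simp: positive_def star_mult star_star)

section \<open>The central element of a weighted C*-algebra\<close>

context weighted_cstar_algebra
begin

lemma hom_scaleR: "\<iota> (r *\<^sub>R a) = r *\<^sub>R \<iota> a"
  by (metis hom_scaleC scaleC_of_real)

lemma linear_hom: "linear \<iota>"
  by (rule linearI) (simp_all add: hom_add hom_scaleR)

lemma bounded_linear_pi: "bounded_linear \<pi>"
proof (rule bounded_linear_intro[where K = 1])
  show "\<pi> (r *\<^sub>R a) = r *\<^sub>R \<pi> a" for r a by (metis pi_scaleC scaleC_of_real)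
qed (simp_all add: pi_add pi_isometric)

lemma inj_pi: "inj \<pi>"
proof (rule injI)
  fix a b assume "\<pi> a = \<pi> b"
  then have "\<pi> (a - b) = 0" by (simp add: linear_diff[OF bounded_linear.linear[OF bounded_linear_pi]])
  then have "norm (a - b) = 0" using pi_isometric[of "a - b"] by simp
  then show "a = b" by simp
qed

lemma dense_induct:
  assumes "closed {x. P x}" "\<And>a. P (\<iota> a)" shows "P x"
proof -
  have "closure (range \<iota>) \<subseteq> {x. P x}" by (rule closure_minimal) (use assms in auto)
  then show ?thesis by (auto simp: dense_range)
qed

text \<open>By density of \<open>A\<close> the assumption extends to \<open>x w = 0\<close> for all
  \<open>x\<close> in \<open>C\<close>, and \<open>C\<close> acts faithfully.\<close>

lemma multiplier_eq_zero:
  assumes "\<And>a. embed (\<iota> a) * w = 0" shows "w = 0"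
proof -
  have "rmult w (\<iota> a) = 0" for a
    using assms[of a] norm_embed[of "rmult w (\<iota> a)"] by (simp add: embed_mult_right)
  then have "rmult w x = 0" for x
    by (rule dense_induct[rotated])
      (intro closed_Collect_eq bounded_linear.continuous_on[OF rmult_bounded_linear] continuous_intros)
  then have "z * lmult w x = z * lmult 0 x" for z x by (simp add: times_lmult)
  then have "lmult w x = lmult 0 x" for x by (rule left_faithful)
  then show ?thesis by (rule multiplier_eqI)
qed

lemma embed_in_range_pi: "embed x \<in> range \<pi>"
proof -
  define J where "J = {x. embed x \<in> range \<pi>}"
  have closed_pi: "closed (range \<pi>)"
    by (rule closed_isometric_image[OF bounded_linear_pi pi_isometric]) auto
  have sub_pi: "subspace (range \<pi>)"
    by (rule linear_subspace_image[OF bounded_linear.linear[OF bounded_linear_pi]]) auto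
  have J: "closed J"
    unfolding J_def using continuous_closed_vimage[OF closed_pi, of embed]
    by (simp add: vimage_def linear_continuous_at[OF bounded_linear_embed])
  have J': "subspace J"
    using linear_subspace_vimage[OF bounded_linear.linear[OF bounded_linear_embed] sub_pi]
    by (simp add: J_def vimage_def)
  have left: "c * j \<in> J" if j: "j \<in> J" for c j
  proof -
    obtain a where a: "\<pi> a = embed j" using j by (force simp: J_def)
    obtain b where "\<iota> b = c * \<iota> a" using left_ideal by (metis rangeE)
    then have "\<pi> b = embed (c * j)" by (simp add: pi_left a embed_mult)
    then show ?thesis unfolding J_def by (metis mem_Collect_eq rangeI)
  qed
  have right: "j * c \<in> J" if j: "j \<in> J" for c j
  proof -
    obtain a where a: "\<pi> a = embed j" using j by (force simp: J_def)
    obtain b where "\<iota> b = \<iota> a * c" using right_ideal by (metis rangeE)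
    then have "\<pi> b = embed (j * c)" by (simp add: pi_right a embed_mult)
    then show ?thesis unfolding J_def by (metis mem_Collect_eq rangeI)
  qed
  have in_J: "\<iota> a * c \<in> J" for a c
  proof -
    obtain d where d: "\<iota> d = \<iota> a * c" using right_ideal by (metis rangeE)
    \<comment> \<open>\<open>M(C) C\<close> lies in \<open>C\<close>, so multiplying
      \<open>a\<close> by \<open>c\<close> brings its image under \<open>\<pi>\<close> into
      \<open>C\<close>.\<close>
    have pd: "\<pi> d = embed (lmult (\<pi> a) c)" using pi_right[OF d] by (simp add: mult_embed)
    then have "lmult (\<pi> a) c \<in> J" unfolding J_def by (metis mem_Collect_eq rangeI)
    then obtain y z where yz: "y \<in> J" "z \<in> J" "lmult (\<pi> a) c = y * z"
      using ideal_factorization[OF J J' _ left right] by blast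
    obtain b where b: "\<pi> b = embed z" using yz(2) unfolding J_def by force
    obtain b' where b': "\<iota> b' = y * \<iota> b" using left_ideal by (metis rangeE)
    have "\<pi> b' = \<pi> d" by (simp add: pi_left[OF b'] b pd yz(3) embed_mult)
    then have "\<iota> d = y * \<iota> b" using inj_pi b' by (metis injD)
    moreover have "y * \<iota> b \<in> J" by (rule right[OF yz(1)])
    ultimately show ?thesis by (simp add: d)
  qed
  obtain y z where x: "x = y * z" by (rule cstar_factorization)
  \<comment> \<open>\<open>in_J\<close> covers products only: \<open>y\<close> is approximated by
    elements \<open>\<iota> a\<close> while \<open>z\<close> stays fixed.\<close>
  have "y * z \<in> J"
    by (rule dense_induct[where P = "\<lambda>y. y * z \<in> J"])
      (use continuous_closed_vimage[OF J, of "\<lambda>y. y * z"] in_J in \<open>simp_all add: vimage_def\<close>)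
  then show ?thesis by (simp add: x J_def)
qed

section \<open>The weight: the inverse of \<open>\<pi>\<close> on \<open>C\<close> as a central
  multiplier\<close>

definition preimage :: "'c \<Rightarrow> 'a"
  where "preimage c = (SOME a. \<pi> a = embed c)"

lemma pi_preimage: "\<pi> (preimage c) = embed c"
  unfolding preimage_def by (rule someI_ex) (metis embed_in_range_pi rangeE)

lemma preimage_eqI: "\<pi> a = embed c \<Longrightarrow> preimage c = a"
  by (metis inj_pi injD pi_preimage)

lemma hom_preimage_left: "\<iota> (preimage (c * d)) = c * \<iota> (preimage d)"
proof -
  obtain b where b: "\<iota> b = c * \<iota> (preimage d)" using left_ideal by (metis rangeE)
  have "\<pi> b = embed (c * d)" by (simp add: pi_left[OF b] pi_preimage embed_mult)
  then show ?thesis using b preimage_eqI by simp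
qed

lemma hom_preimage_right: "\<iota> (preimage (c * d)) = \<iota> (preimage c) * d"
proof -
  obtain b where b: "\<iota> b = \<iota> (preimage c) * d" using right_ideal by (metis rangeE)
  have "\<pi> b = embed (c * d)" by (simp add: pi_right[OF b] pi_preimage embed_mult)
  then show ?thesis using b preimage_eqI by simp
qed

text \<open>The same map serves as both components because it is a bimodule map; this is the source
  of centrality.\<close>

definition weight :: "'c multiplier"
  where "weight = mk_multiplier (\<lambda>c. \<iota> (preimage c)) (\<lambda>c. \<iota> (preimage c))"

lemma dc_weight: "double_centralizer (\<lambda>c. \<iota> (preimage c)) (\<lambda>c. \<iota> (preimage c))"
  unfolding double_centralizer_def
  by (intro allI conjI) (metis hom_preimage_right hom_preimage_left)+

lemma lmult_weight: "lmult weight c = \<iota> (preimage c)"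
  and rmult_weight: "rmult weight c = \<iota> (preimage c)"
  by (simp_all add: weight_def lmult_mk[OF dc_weight] rmult_mk[OF dc_weight])

text \<open>A left factor \<open>z\<close> turns \<open>z (m x)\<close> into \<open>(z m) x\<close>
  with \<open>z m\<close> in \<open>C\<close>, where the left linearity of \<open>preimage\<close>
  applies.\<close>

lemma weight_commute: "weight * m = m * weight"
proof (rule multiplier_eqI)
  fix x
  have "z * \<iota> (preimage (lmult m x)) = z * lmult m (\<iota> (preimage x))" for z
    by (metis hom_preimage_left times_lmult)
  then have "\<iota> (preimage (lmult m x)) = lmult m (\<iota> (preimage x))" by (rule left_faithful)
  then show "lmult (weight * m) x = lmult (m * weight) x"
    by (simp add: lmult_weight)
qed

lemma weight_centre: "weight \<in> centre"
  using weight_commute by (simp add: centre_def)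

text \<open>For \<open>x\<close> in \<open>C\<close>, the element \<open>\<pi> a x\<close> of
  \<open>C\<close> is the image of \<open>a x\<close> under \<open>\<pi>\<close>, so
  \<open>preimage\<close> returns \<open>a x\<close>.\<close>

lemma weight_pi: "weight * \<pi> a = embed (\<iota> a)"
proof (rule multiplier_eqI)
  fix x
  obtain b where b: "\<iota> b = \<iota> a * x" using right_ideal by (metis rangeE)
  have "preimage (lmult (\<pi> a) x) = b" by (intro preimage_eqI) (simp add: pi_right[OF b] mult_embed)
  then show "lmult (weight * \<pi> a) x = lmult (embed (\<iota> a)) x" by (simp add: lmult_weight b)
qed

lemma weight_embed: "weight * embed c = embed (\<iota> (preimage c))"
  by (simp add: mult_embed lmult_weight)

section \<open>Self-adjointness and positivity of the weight\<close>

lemma star_mult_in_range: obtains b where "\<iota> b = star (\<iota> a) * \<iota> a"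
  using left_ideal by (metis rangeE)

text \<open>For \<open>\<iota> b = star (\<iota> a) * \<iota> a\<close> both
  \<open>\<iota> b\<close> and \<open>\<pi> b\<close> are hermitian, so taking adjoints in
  \<open>\<iota> b = u \<pi> b\<close> shows that \<open>w = u - star u\<close> kills
  \<open>\<pi> b\<close>. Being central, \<open>w\<close> then kills \<open>\<iota> b\<close> and so
  \<open>\<iota> a\<close>.\<close>

lemma star_weight: "star weight = weight"
proof -
  define w where "w = weight - star weight"
  have wc: "w * m = m * w" for m
    using weight_centre star_centre[OF weight_centre] by (simp add: w_def centre_def algebra_simps)
  have "embed (\<iota> a) * w = 0" for a
  proof -
    obtain b where b: "\<iota> b = star (\<iota> a) * \<iota> a" by (rule star_mult_in_range)
    then have "positive (\<iota> b)" by (auto simp: positive_def)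
    then have "star (\<pi> b) = \<pi> b" by (intro positive_hermitian pi_positive)
    then have "star (embed (\<iota> b)) = \<pi> b * star weight"
      by (simp flip: weight_pi add: star_mult)
    moreover have "star (embed (\<iota> b)) = embed (\<iota> b)"
      by (simp add: b star_mult star_star flip: embed_star)
    moreover have "\<pi> b * star weight = star weight * \<pi> b"
      using star_centre[OF weight_centre] by (simp add: centre_def)
    ultimately have "w * \<pi> b = 0" by (simp add: w_def left_diff_distrib weight_pi)
    then have "w * embed (\<iota> b) = 0"
      by (metis mult.assoc mult_zero_right wc weight_pi)
    then have "star (embed (\<iota> a)) * embed (\<iota> a) * w = 0"
      by (simp add: b embed_mult embed_star wc)
    then have "star (embed (\<iota> a) * w) * (embed (\<iota> a) * w) = 0"
      by (simp add: star_mult mult.assoc)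
    then show ?thesis by simp
  qed
  then have "w = 0" by (rule multiplier_eq_zero)
  then show ?thesis by (simp add: w_def)
qed

text \<open>\<open>e * e\<close> plays the role of the absolute value of \<open>u\<close> and is
  visibly positive. Centrality follows from the bicommutant property, since \<open>1 - v * v\<close>
  is central.\<close>

lemma weight_fourth_root:
  obtains e where "star e = e" "(e * e) * (e * e) = weight * weight" "e \<in> centre"
proof -
  define c where "c = norm weight + 1"
  have c: "c > 0" by (simp add: c_def add_nonneg_pos)
  define v where "v = (1 / c) *\<^sub>R weight"
  have v: "star v = v" by (simp add: v_def star_scaleR star_weight)
  have nv: "norm v \<le> 1" using c by (simp add: v_def c_def)
  have vc: "v * m = m * v" for m by (simp add: v_def weight_commute)
  have "star (1 - v * v) = 1 - v * v" by (simp add: star_diff star_mult v)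
  then obtain e where e: "star e = e" "(e * e) * (e * e) = 1 - (1 - v * v)" "bicommutes (1 - v * v) e"
    using fourth_root_one_minus[OF _ norm_one_minus_square_le(1)[OF v nv]] by blast
  have "m * (v * v) = v * v * m" for m by (rule commute_mult) (simp_all add: vc)
  then have ec: "m * e = e * m" for m
    by (intro bicommutesD[OF e(3)]) (simp add: right_diff_distrib left_diff_distrib)
  show thesis
  proof (rule that[of "sqrt c *\<^sub>R e"])
    have "(sqrt c *\<^sub>R e * sqrt c *\<^sub>R e) * (sqrt c *\<^sub>R e * sqrt c *\<^sub>R e) =
        (c * c) *\<^sub>R ((e * e) * (e * e))"
      using c by simp
    then show "(sqrt c *\<^sub>R e * sqrt c *\<^sub>R e) * (sqrt c *\<^sub>R e * sqrt c *\<^sub>R e) = weight * weight"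
      using c by (simp only: e(2)) (simp add: v_def)
  qed (simp_all add: star_scaleR e(1) centre_def ec)
qed

text \<open>
  Let \<open>e\<^sup>4 = u\<^sup>2\<close> and \<open>n = e\<^sup>2 - u\<close>, twice the negative part of \<open>u\<close>, so that \<open>u n = - e\<^sup>2 n\<close>.
  If \<open>\<iota> b = h\<^sup>2\<close> and \<open>\<pi> b = y\<^sup>* y\<close>, then \<open>z = n e y\<close> satisfies \<open>z\<^sup>* z = - (n h)\<^sup>2\<close>, hence \<open>n h = 0\<close>.
\<close>

lemma positive_weight: "positive weight"
proof -
  obtain e where e: "star e = e" "(e * e) * (e * e) = weight * weight" "e \<in> centre"
    by (rule weight_fourth_root)
  have ec: "e * m = m * e" for m using e(3) by (simp add: centre_def)
  define n where "n = e * e - weight"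
  have nc: "n * m = m * n" for m
  proof -
    have "m * (e * e) = e * e * m" by (rule commute_mult) (simp_all add: ec)
    then show ?thesis by (simp add: n_def algebra_simps weight_commute)
  qed
  have sn: "star n = n" by (simp add: n_def star_diff star_mult e(1) star_weight)
  have ne: "n * (e * e) = - (n * weight)"
    by (simp add: n_def left_diff_distrib e(2) weight_commute[of "e * e"])
  have "embed (\<iota> a) * n = 0" for a
  proof -
    \<comment> \<open>Squaring twice makes \<open>\<iota> b\<close> the square of the hermitian
      \<open>h\<close>, which is itself \<open>star (\<iota> a) * \<iota> a\<close>; thus
      \<open>n h = 0\<close> leads back to \<open>\<iota> a\<close>.\<close>
    obtain d where d: "\<iota> d = star (\<iota> a) * \<iota> a" by (rule star_mult_in_range)
    obtain b where b: "\<iota> b = star (\<iota> d) * \<iota> d" by (rule star_mult_in_range)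
    define h where "h = embed (\<iota> d)"
    have h: "h = star (embed (\<iota> a)) * embed (\<iota> a)" by (simp add: h_def d embed_mult embed_star)
    have sh: "star h = h" by (simp add: h star_mult star_star)
    have ub: "weight * \<pi> b = h * h"
      using sh by (simp add: weight_pi b embed_mult embed_star h_def)
    have "positive (\<pi> b)" by (rule pi_positive) (auto simp: positive_def b)
    then obtain y where y: "\<pi> b = star y * y" by (auto simp: positive_def)
    define z where "z = n * (e * y)"
    have "star z * z = star y * (e * (n * n)) * (e * y)"
      by (simp add: z_def star_mult sn e(1) mult.assoc)
    also have "\<dots> = star y * (n * n * (e * e)) * y"
      by (simp only: ec[of "n * n"] mult.assoc)
    also have "star y * (n * n * (e * e)) = n * n * (e * e) * star y"
      by (intro commute_mult) (simp_all only: nc ec)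
    also have "n * n * (e * e) * star y * y = n * (n * (e * e)) * (star y * y)"
      by (simp only: mult.assoc)
    also have "\<dots> = - (n * n * (weight * \<pi> b))" by (simp add: ne y mult.assoc)
    also have "n * n * (weight * \<pi> b) = n * (n * h) * h" unfolding ub by (simp only: mult.assoc)
    also have "\<dots> = n * (h * n) * h" by (simp only: nc[of h])
    also have "\<dots> = (n * h) * (n * h)" by (simp only: mult.assoc)
    finally have zz: "star z * z = - ((n * h) * (n * h))" .
    have snh: "star (n * h) = n * h" by (simp add: star_mult sn sh nc)
    have "z = 0" using snh zz by (rule star_mult_eq_minus_square_imp_zero)
    then have "star (n * h) * (n * h) = 0" using zz by (simp add: snh)
    then have nh: "n * h = 0" by simp
    have "star (embed (\<iota> a) * n) * (embed (\<iota> a) * n) = n * h * n"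
      by (simp add: star_mult sn h mult.assoc)
    then show ?thesis by (simp add: nh)
  qed
  then have "n = 0" by (rule multiplier_eq_zero)
  then have "weight = star e * e" by (simp add: n_def e(1))
  then show ?thesis by (auto simp: positive_def)
qed

section \<open>The approximate ideal and the multipliers\<close>

text \<open>The unit ball of \<open>\<pi>(A)\<close> contains that of \<open>C\<close>, so the supremum is the norm of \<open>C\<close>.\<close>

lemma multiplier_norm_eq: "multiplier_norm a = norm (\<iota> a)"
proof -
  define N where "N = {norm (a * b) |b. norm b \<le> 1} \<union> {norm (b * a) |b. norm b \<le> 1}"
  have le: "norm (embed (\<iota> a)) * norm b \<le> norm (\<iota> a)" if "norm b \<le> 1" for b :: 'a
    using that by (simp add: norm_embed mult_left_le)
  have ub: "r \<le> norm (\<iota> a)" if r: "r \<in> N" for r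
  proof -
    obtain b where b: "norm b \<le> 1" "r = norm (a * b) \<or> r = norm (b * a)"
      using r unfolding N_def by blast
    \<comment> \<open>\<open>\<pi> (a b) = \<iota> a \<pi> b\<close>, so the isometry of
      \<open>\<pi>\<close> compares the norm of \<open>A\<close> with that of
      \<open>C\<close>.\<close>
    have "norm (a * b) \<le> norm (embed (\<iota> a)) * norm b"
      using norm_mult_ineq[of "embed (\<iota> a)" "\<pi> b"] pi_left[OF hom_mult, of a b]
      by (metis pi_isometric)
    moreover have "norm (b * a) \<le> norm b * norm (embed (\<iota> a))"
      using norm_mult_ineq[of "\<pi> b" "embed (\<iota> a)"] pi_right[OF hom_mult, of b a]
      by (metis pi_isometric)
    ultimately show ?thesis using b(2) le[OF b(1)] by (auto simp: mult.commute)
  qed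
  have bdd: "bdd_above N" using ub by (rule bdd_aboveI)
  have zero: "0 \<in> N" by (auto simp: N_def intro!: exI[of _ 0])
  have "norm (\<iota> a) \<le> Sup N"
  proof (rule norm_le_right_mult)
    show "0 \<le> Sup N" using zero bdd by (rule cSup_upper)
    fix z
    show "norm (\<iota> a * z) \<le> Sup N * norm z"
    proof (cases "z = 0")
      case False
      define b where "b = preimage ((1 / norm z) *\<^sub>R z)"
      have "norm b = norm (\<pi> b)" by (simp add: pi_isometric)
      also have "\<dots> = 1" using False by (simp add: b_def pi_preimage norm_embed)
      finally have "norm (a * b) \<in> N" by (auto simp: N_def)
      then have "norm (a * b) \<le> Sup N" using bdd by (rule cSup_upper)
      moreover have "\<pi> (a * b) = embed ((1 / norm z) *\<^sub>R (\<iota> a * z))"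
        by (simp add: pi_left[OF hom_mult] b_def pi_preimage flip: embed_mult)
      then have "norm (a * b) = norm (\<iota> a * z) / norm z"
        using pi_isometric[of "a * b"] by (simp add: norm_embed)
      ultimately show ?thesis using False by (simp add: field_simps)
    qed simp
  qed
  moreover have "Sup N \<le> norm (\<iota> a)" using zero ub by (intro cSup_least) auto
  ultimately show ?thesis by (simp add: multiplier_norm_def N_def)
qed

lemma multiplier_Cauchy_iff: "multiplier_Cauchy X \<longleftrightarrow> Cauchy (\<lambda>n. \<iota> (X n))"
  by (simp add: multiplier_Cauchy_def Cauchy_def dist_norm multiplier_norm_eq linear_diff[OF linear_hom])

text \<open>The completion is \<open>C\<close>: Cauchy sequences for the multiplier norm converge in
  \<open>C\<close>, and by density each \<open>c\<close> is such a limit.\<close>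

lemma approximate_ideal_eq: "approximate_ideal = {y. \<exists>a c. \<iota> y = \<iota> a * c}"
proof (intro set_eqI iffI)
  fix y :: 'a assume "y \<in> approximate_ideal"
  then obtain a X where "Cauchy (\<lambda>n. \<iota> (X n))"
      and lim: "(\<lambda>n. norm (\<iota> a * \<iota> (X n) - \<iota> y)) \<longlonglongrightarrow> 0"
    by (auto simp: approximate_ideal_def multiplier_Cauchy_iff multiplier_norm_eq
        linear_diff[OF linear_hom] hom_mult)
  then obtain c where "(\<lambda>n. \<iota> (X n)) \<longlonglongrightarrow> c" using Cauchy_convergent_iff convergent_def by metis
  then have "(\<lambda>n. \<iota> a * \<iota> (X n)) \<longlonglongrightarrow> \<iota> a * c" by (intro tendsto_intros)
  moreover have "(\<lambda>n. \<iota> a * \<iota> (X n)) \<longlonglongrightarrow> \<iota> y"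
    using lim by (simp add: tendsto_norm_zero_iff LIM_zero_iff)
  ultimately have "\<iota> y = \<iota> a * c" by (metis LIMSEQ_unique)
  then show "y \<in> {y. \<exists>a c. \<iota> y = \<iota> a * c}" by blast
next
  fix y :: 'a assume "y \<in> {y. \<exists>a c. \<iota> y = \<iota> a * c}"
  then obtain a c where y: "\<iota> y = \<iota> a * c" by blast
  have "c \<in> closure (range \<iota>)" by (simp add: dense_range)
  then obtain Y where Y: "\<And>n. Y n \<in> range \<iota>" "Y \<longlonglongrightarrow> c" by (auto simp: closure_sequential)
  define X where "X n = inv \<iota> (Y n)" for n
  have X: "(\<lambda>n. \<iota> (X n)) = Y" using Y(1) by (auto simp: X_def f_inv_into_f)
  have "(\<lambda>n. \<iota> a * \<iota> (X n) - \<iota> y) \<longlonglongrightarrow> \<iota> a * c - \<iota> a * c"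
    unfolding y using Y(2) unfolding X[symmetric] by (intro tendsto_intros)
  then have "(\<lambda>n. multiplier_norm (a * X n - y)) \<longlonglongrightarrow> 0"
    by (simp add: multiplier_norm_eq linear_diff[OF linear_hom] hom_mult tendsto_norm_zero)
  moreover have "multiplier_Cauchy X"
    using Y(2) by (simp add: multiplier_Cauchy_iff X LIMSEQ_imp_Cauchy)
  ultimately show "y \<in> approximate_ideal" unfolding approximate_ideal_def by blast
qed

text \<open>\<open>a c = u (\<pi> a c)\<close> with \<open>\<pi> a c\<close> in \<open>C\<close>.
  Conversely, \<open>c = y z\<close> gives \<open>u c = (u y) z\<close> with \<open>u y\<close> in
  \<open>A\<close>.\<close>

lemma embed_approximate_ideal:
  "(\<lambda>a. embed (\<iota> a)) ` approximate_ideal = range (\<lambda>c. weight * embed c)"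
proof (intro set_eqI iffI)
  fix m assume "m \<in> (\<lambda>a. embed (\<iota> a)) ` approximate_ideal"
  then obtain a c where "m = embed (\<iota> a * c)" by (auto simp: approximate_ideal_eq)
  then have "m = weight * embed (lmult (\<pi> a) c)"
    by (simp add: embed_mult weight_pi[symmetric] mult.assoc mult_embed)
  then show "m \<in> range (\<lambda>c. weight * embed c)" by blast
next
  fix m assume "m \<in> range (\<lambda>c. weight * embed c)"
  then obtain c where m: "m = embed (\<iota> (preimage c))" by (auto simp: weight_embed)
  obtain y z where "c = y * z" by (rule cstar_factorization)
  then have "preimage c \<in> approximate_ideal"
    by (auto simp: approximate_ideal_eq hom_preimage_right)
  then show "m \<in> (\<lambda>a. embed (\<iota> a)) ` approximate_ideal" by (auto simp: m)
qed

lemma weight_mult_in_C_multipliers: "weight * m \<in> C_multipliers \<iota>"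
proof -
  define ml where "ml x = preimage (lmult m x)" for x
  define mr where "mr x = preimage (rmult m x)" for x
  have l: "lmult (weight * m) = \<iota> \<circ> ml" by (auto simp: lmult_weight ml_def)
  \<comment> \<open>The right action of a product applies its left factor first, so the weight is
    moved to the right to act last and land in \<open>A\<close>.\<close>
  have r: "rmult (weight * m) = \<iota> \<circ> mr"
    by (auto simp: weight_commute[of m] rmult_weight mr_def)
  have "\<iota> (ml x) = lmult (weight * m) x" "\<iota> (mr x) = rmult (weight * m) x" for x
    by (simp_all only: l r o_apply)
  then have "(ml, mr) \<in> C_multiplier_pairs \<iota>"
    unfolding C_multiplier_pairs_def
    by (simp add: lmult_times rmult_times times_lmult del: lmult_simps rmult_simps)
  then show ?thesis unfolding C_multipliers_def using l r by blast
qed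

text \<open>Factoring \<open>x = y z\<close> shows that \<open>\<pi> (ml x) = \<pi> (ml y) z\<close>
  lies in \<open>C\<close>, and likewise for \<open>mr\<close>. So \<open>\<pi>\<close> turns the
  pair into a multiplier of \<open>C\<close>, and the weight turns it back into
  \<open>m\<close>.\<close>

lemma C_multipliers_subset: "C_multipliers \<iota> \<subseteq> range (\<lambda>m. weight * m)"
proof
  fix m assume "m \<in> C_multipliers \<iota>"
  then obtain ml mr where pair: "(ml, mr) \<in> C_multiplier_pairs \<iota>"
      and l: "lmult m = \<iota> \<circ> ml"
    by (auto simp: C_multipliers_def)
  have ml: "\<iota> (ml (x * y)) = \<iota> (ml x) * y" and mr: "\<iota> (mr (x * y)) = x * \<iota> (mr y)"
      and mlr: "x * \<iota> (ml y) = \<iota> (mr x) * y" for x y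
    using pair by (auto simp: C_multiplier_pairs_def)
  have "\<exists>d. \<pi> (ml x) = embed d" for x
  proof -
    obtain y z where "x = y * z" by (rule cstar_factorization)
    then show ?thesis using pi_right[OF ml, of y z] by (metis mult_embed)
  qed
  then obtain L where L: "\<And>x. \<pi> (ml x) = embed (L x)" by metis
  have "\<exists>d. \<pi> (mr x) = embed d" for x
  proof -
    obtain y z where "x = y * z" by (rule cstar_factorization)
    then show ?thesis using pi_left[OF mr, of y z] by (metis embed_mult_right)
  qed
  then obtain R where R: "\<And>x. \<pi> (mr x) = embed (R x)" by metis
  have dc: "double_centralizer L R"
    unfolding double_centralizer_def
  proof (intro allI conjI)
    fix x y
    have "embed (L (x * y)) = embed (L x * y)"
      using pi_right[OF ml, of x y] by (simp add: L embed_mult)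
    then show "L (x * y) = L x * y" by (simp only: embed_inject)
    have "embed (R (x * y)) = embed (x * R y)"
      using pi_left[OF mr, of x y] by (simp add: R embed_mult)
    then show "R (x * y) = x * R y" by (simp only: embed_inject)
    obtain d where d: "\<iota> d = x * \<iota> (ml y)" using left_ideal by (metis rangeE)
    have "embed (x * L y) = embed (R x * y)"
      using pi_left[OF d] pi_right[OF d[unfolded mlr]] by (simp add: L R embed_mult)
    then show "x * L y = R x * y" by (simp only: embed_inject)
  qed
  have "m = weight * mk_multiplier L R"
    by (rule multiplier_eqI)
      (simp add: lmult_mk[OF dc] lmult_weight l preimage_eqI[OF L])
  then show "m \<in> range (\<lambda>m. weight * m)" by blast
qed

end

theorem theorem3p19:
  fixes \<iota> :: "'a::complex_banach_algebra \<Rightarrow> 'c::cstar_algebra"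
    and \<pi> :: "'a \<Rightarrow> 'c multiplier"
  assumes "weighted_cstar_algebra \<iota> \<pi>"
  shows "\<exists>u \<in> centre. positive u \<and>
    range (\<lambda>a. embed (\<iota> a)) = range (\<lambda>a. u * \<pi> a) \<and>
    (\<lambda>a. embed (\<iota> a)) ` approximate_ideal = range (\<lambda>c. u * embed c) \<and>
    C_multipliers \<iota> = range (\<lambda>m. u * m)"
proof -
  interpret weighted_cstar_algebra \<iota> \<pi> by (rule assms)
  have "C_multipliers \<iota> = range (\<lambda>m. weight * m)"
    using C_multipliers_subset weight_mult_in_C_multipliers by blast
  then show ?thesis
    by (intro bexI[OF _ weight_centre] conjI positive_weight embed_approximate_ideal)
      (simp_all add: weight_pi)
qed

end
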